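(* Let $d\ge 2$. Then $$I_d=(f^{(d)})+\mathscr{I}_d^3,$$ where $(f^{(d)})=f^{(d)}\cdot R_d$ is the principal ideal generated by $f^{(d)}$ and $\mathscr I_d^3$ is the third power of the ideal $\mathscr I_d$.
   Context: Let $d\ge2$ and let $R_d=\mathbb Z[u_1^{\pm1},\dots,u_d^{\pm1}]$ be the ring of Laurent polynomials with integer coefficients. Elements $w=(w_{\mathbf n})\in\mathbb R^{\mathbb Z^d}$ are identified with formal series $\sum_{\mathbf n}w_{\mathbf n}u^{\mathbf n}$, $u^{\mathbf n}=u_1^{n_1}\cdots u_d^{n_d}$; in particular $h\in R_d$ is identified with its finitely supported integer coefficient sequence. For $h\in R_d$ and $w\in\mathbb R^{\mathbb Z^d}$ the product is $(h\cdot w)_{\mathbf n}=\sum_{\mathbf k}h_{\mathbf k}w_{\mathbf n-\mathbf k}$. Let $f^{(d)}=2d-\sum_{i=1}^d(u_i+u_i^{-1})\in R_d$ and $F^{(d)}(\mathbf t)=2d-2\sum_{j=1}^d\cos(2\pi t_j)$ for $\mathbf t\in\mathbb T^d=(\mathbb R/\mathbb Z)^d$; write $\langle\mathbf n,\mathbf t\rangle=\sum_j n_jt_j$. Define $w^{(d)}\in\mathbb R^{\mathbb Z^d}$ by $w^{(2)}_{\mathbf n}=\int_{\mathbb T^2}\frac{e^{-2\pi i\langle\mathbf n,\mathbf t\rangle}-1}{F^{(2)}(\mathbf t)}\,d\mathbf t$ for $d=2$, and $w^{(d)}_{\mathbf n}=\int_{\mathbb T^d}\frac{e^{-2\pi i\langle\mathbf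 n,\mathbf t\rangle}}{F^{(d)}(\mathbf t)}\,d\mathbf t$ for $d\ge3$ (a multiple of the lattice Green's function of simple random walk; it satisfies $f^{(d)}\cdot w^{(d)}=1$, i.e. equals the indicator of $\mathbf 0$). Define $I_d=\{g\in R_d: g\cdot w^{(d)}\in\ell^1(\mathbb Z^d)\}$ and $\mathscr I_d=\{h\in R_d: h(1,\dots,1)=0\}=(1-u_1)R_d+\dots+(1-u_d)R_d$. *)

theory Defs
  imports "HOL-Analysis.Analysis" "HOL-Library.Poly_Mapping" "HOL-Library.Function_Algebras"
begin

text \<open>Lattice points of Z^d are functions 'n => int for a finite index type 'n with CARD('n) = d.
  The Laurent polynomial ring R_d = Z[u_1^(+-1),...,u_d^(+-1)] is the group ring of Z^d,
  i.e. finitely supported integer coefficient functions (poly_mapping), a comm_ring_1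
  whose multiplication is convolution.\<close>

type_synonym 'n laurent = "('n \<Rightarrow> int) \<Rightarrow>\<^sub>0 int"

definition unitvec :: "'n \<Rightarrow> ('n \<Rightarrow> int)" where
  "unitvec i = (\<lambda>j. if j = i then 1 else 0)"

definition mono :: "('n \<Rightarrow> int) \<Rightarrow> 'n laurent" where
  "mono n = Poly_Mapping.single n 1"

definition fd :: "('n::finite) laurent" where
  "fd = of_nat (2 * CARD('n)) - (\<Sum>i\<in>UNIV. mono (unitvec i) + mono (- unitvec i))"

definition eval_one :: "'n laurent \<Rightarrow> int" where
  "eval_one h = (\<Sum>k\<in>Poly_Mapping.keys h. Poly_Mapping.lookup h k)"

definition Fd :: "real ^ ('n::finite) \<Rightarrow> real" where
  "Fd t = 2 * real CARD('n) - 2 * (\<Sum>j\<in>UNIV. cos (2 * pi * (t $ j)))"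

definition lat_inner :: "('n::finite \<Rightarrow> int) \<Rightarrow> real ^ 'n \<Rightarrow> real" where
  "lat_inner n t = (\<Sum>j\<in>UNIV. real_of_int (n j) * (t $ j))"

text \<open>w^(d), integrating over the fundamental domain [0,1]^d of the torus (values are real,
  but we keep them as complex numbers; the imaginary parts vanish).\<close>
definition wd :: "('n::finite \<Rightarrow> int) \<Rightarrow> complex" where
  "wd n = (if CARD('n) = 2 then
      set_lebesgue_integral lborel (cbox 0 One)
        (\<lambda>t::real^'n. (cis (- 2 * pi * lat_inner n t) - 1) / complex_of_real (Fd t))
    else
      set_lebesgue_integral lborel (cbox 0 One)
        (\<lambda>t::real^'n. cis (- 2 * pi * lat_inner n t) / complex_of_real (Fd t)))"

definition act :: "('n::finite) laurent \<Rightarrow> (('n \<Rightarrow> int) \<Rightarrow> complex) \<Rightarrow> ('n \<Rightarrow> int) \<Rightarrow> complex" where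
  "act h w n = (\<Sum>k\<in>Poly_Mapping.keys h. of_int (Poly_Mapping.lookup h k) * w (n - k))"

definition Id_set :: "('n::finite) laurent set" where
  "Id_set = {g. (\<lambda>n. norm (act g wd n)) summable_on UNIV}"

definition augm_ideal :: "('n::finite) laurent set" where
  "augm_ideal = {h. eval_one h = 0}"

definition ideal_mult :: "'a::comm_ring_1 set \<Rightarrow> 'a set \<Rightarrow> 'a set" where
  "ideal_mult A B = {x. \<exists>xs. set xs \<subseteq> A \<times> B \<and> x = sum_list (map (\<lambda>(a, b). a * b) xs)}"

definition principal_ideal :: "'a::comm_ring_1 \<Rightarrow> 'a set" where
  "principal_ideal f = {f * q | q. True}"

definition ideal_sum :: "'a::comm_ring_1 set \<Rightarrow> 'a set \<Rightarrow> 'a set" where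
  "ideal_sum A B = {a + b | a b. a \<in> A \<and> b \<in> B}"

end

(* Write x_i = u_i - 1 and N = 4 d - f. Since 1/F is the sum of (4d - F)^m / (4d)^(m+1), the series h w is
   the sum of h N^m / (4d)^(m+1) whenever |h^| is bounded by a multiple of F on the torus. Here N is the sum of the
   u_i^(-1) (1 + u_i)^2, so N^m / (4d)^m is a lazy random walk distribution, and the binomial theorem
   together with the variance of the binomial distribution gives ||x_i N^m||_1 = O((4d)^m / sqrt m). Splitting N^m into three
   factors, ||x_i x_j x_k N^m||_1 = O((4d)^m m^(-3/2)), which is summable; hence the cube of the augmentation
   ideal lies in I_d.
   Conversely, if g w is summable then g^ = F phi with phi continuous, because f (g w) = g. Modulo the cube of the
   augmentation ideal, g = a + sum b_i x_i + sum c_ij x_i x_j, and comparing both sides to second order along lines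
   through 0 yields a = b_i = 0 and that the quadratic form of c is a multiple of |v|^2; since sum x_i^2 = -f modulo the
   cube, g lies in (f) plus the cube. *)
theory Submission
  imports Defs
begin

section \<open>Coefficient pairings and the coefficient norm\<close>

text \<open>No asymptotics of the Green function enter; only \<open>l^1\<close> bounds for finitely
  supported coefficient sequences do. Simple random walk would not serve: its multiplier
  \<open>1 - F/(2d)\<close> equals -1 where all \<open>t_j = 1/2\<close>, and there its geometric
  series for 1/F does not converge, whereas \<open>(4d - F)/(4d)\<close> lies in [0, 1] and equals 1
  only where F = 0. Laziness also makes each summand of N a unit times the square of
  \<open>1 + u_i\<close>, so that \<open>x_i\<close> meets a pure power of \<open>1 + u_i\<close>,
  whose coefficients are explicit. Each factor \<open>x_i\<close> gains m^(-1/2): two of them would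
  leave the divergent sum of 1/m, three give a convergent sum. For d = 2 the function 1/F is not
  integrable. The constant subtracted in w is harmless, since an h with h(1) = 0 annihilates
  constants. In the converse the cube can be removed from g at once because it is already known to
  lie in I_d. That the multiple of f is an integral one needs no extra argument: every integer c_ii
  equals minus the value of \<phi> at 0.\<close>

definition pairing :: "('a \<Rightarrow>\<^sub>0 int) \<Rightarrow> ('a \<Rightarrow> 'b::comm_ring_1) \<Rightarrow> 'b" where
  "pairing h \<phi> = (\<Sum>k\<in>Poly_Mapping.keys h. of_int (Poly_Mapping.lookup h k) * \<phi> k)"

lemma pairing_superset:
  assumes "finite S" "Poly_Mapping.keys h \<subseteq> S"
  shows "pairing h \<phi> = (\<Sum>k\<in>S. of_int (Poly_Mapping.lookup h k) * \<phi> k)"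
  unfolding pairing_def using assms
  by (intro sum.mono_neutral_left) (auto simp: in_keys_iff)

lemma pairing_zero [simp]: "pairing 0 \<phi> = 0"
  by (simp add: pairing_def)

lemma pairing_add: "pairing (p + q) \<phi> = pairing p \<phi> + pairing q \<phi>"
proof -
  let ?S = "Poly_Mapping.keys p \<union> Poly_Mapping.keys q"
  have "pairing (p + q) \<phi> = (\<Sum>k\<in>?S. of_int (Poly_Mapping.lookup (p + q) k) * \<phi> k)"
    by (rule pairing_superset) (auto simp: keys_add)
  also have "\<dots> = (\<Sum>k\<in>?S. of_int (Poly_Mapping.lookup p k) * \<phi> k)
      + (\<Sum>k\<in>?S. of_int (Poly_Mapping.lookup q k) * \<phi> k)"
    by (simp add: lookup_add distrib_right sum.distrib)
  also have "\<dots> = pairing p \<phi> + pairing q \<phi>"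
    by (simp add: pairing_superset[of ?S])
  finally show ?thesis .
qed

lemma pairing_uminus: "pairing (- p) \<phi> = - pairing p \<phi>"
  by (simp add: pairing_def sum_negf)

lemma pairing_diff: "pairing (p - q) \<phi> = pairing p \<phi> - pairing q \<phi>"
  using pairing_add[of p "- q" \<phi>] by (simp add: pairing_uminus)

lemma pairing_sum: "pairing (\<Sum>i\<in>A. h i) \<phi> = (\<Sum>i\<in>A. pairing (h i) \<phi>)"
  by (induction A rule: infinite_finite_induct) (auto simp: pairing_add)

lemma pairing_single: "pairing (Poly_Mapping.single k c) \<phi> = of_int c * \<phi> k"
  by (cases "c = 0") (auto simp: pairing_def)

lemma poly_mapping_sum_singles:
  "(\<Sum>k\<in>Poly_Mapping.keys h. Poly_Mapping.single k (Poly_Mapping.lookup h k)) = h"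
  by (rule poly_mapping_eqI)
    (auto simp: lookup_sum lookup_single when_def in_keys_iff)

lemma poly_mapping_mult_sum:
  fixes p q :: "'a::monoid_add \<Rightarrow>\<^sub>0 int"
  shows "p * q = (\<Sum>k\<in>Poly_Mapping.keys p. \<Sum>l\<in>Poly_Mapping.keys q.
    Poly_Mapping.single (k + l) (Poly_Mapping.lookup p k * Poly_Mapping.lookup q l))"
proof -
  have "p * q = (\<Sum>k\<in>Poly_Mapping.keys p. Poly_Mapping.single k (Poly_Mapping.lookup p k))
      * (\<Sum>l\<in>Poly_Mapping.keys q. Poly_Mapping.single l (Poly_Mapping.lookup q l))"
    by (simp only: poly_mapping_sum_singles)
  then show ?thesis
    by (simp add: sum_product mult_single)
qed

text \<open>Convolution turns into iterated evaluation. With \<phi> a translate of a sequence this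
  makes \<open>act\<close> a module action, with \<phi> a character it makes \<open>fhat\<close>
  multiplicative; both are instances of \<open>pairing\<close>.\<close>

lemma pairing_mult:
  fixes p q :: "'a::monoid_add \<Rightarrow>\<^sub>0 int"
  shows "pairing (p * q) \<phi> = pairing p (\<lambda>k. pairing q (\<lambda>l. \<phi> (k + l)))"
  by (subst poly_mapping_mult_sum)
    (simp add: pairing_sum pairing_single pairing_def[of p] pairing_def[of q]
      sum_distrib_left mult.assoc)

lemma pairing_one: "pairing 1 \<phi> = \<phi> 0"
  using pairing_single[of 0 1 \<phi>] by simp

lemma pairing_mono: "pairing (mono k) \<phi> = \<phi> k"
  by (simp add: mono_def pairing_single)

lemma mono_add: "mono (k + l) = mono k * mono l"
  by (simp add: mono_def mult_single)

lemma mono_zero: "mono 0 = 1"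
  by (simp add: mono_def)

lemma act_eq_pairing: "act h w n = pairing h (\<lambda>k. w (n - k))"
  by (simp add: act_def pairing_def)

lemma act_add: "act (p + q) w n = act p w n + act q w n"
  by (simp add: act_eq_pairing pairing_add)

lemma act_mult: "act (p * q) w = act p (act q w)"
  by (rule ext) (simp add: act_eq_pairing pairing_mult diff_diff_eq)

definition norm1 :: "('a \<Rightarrow>\<^sub>0 int) \<Rightarrow> int" where
  "norm1 h = (\<Sum>k\<in>Poly_Mapping.keys h. \<bar>Poly_Mapping.lookup h k\<bar>)"

lemma norm1_superset:
  assumes "finite S" "Poly_Mapping.keys h \<subseteq> S"
  shows "norm1 h = (\<Sum>k\<in>S. \<bar>Poly_Mapping.lookup h k\<bar>)"
  unfolding norm1_def using assms
  by (intro sum.mono_neutral_left) (auto simp: in_keys_iff)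

lemma norm1_nonneg: "0 \<le> norm1 h"
  by (simp add: norm1_def sum_nonneg)

lemma norm1_zero [simp]: "norm1 0 = 0"
  by (simp add: norm1_def)

lemma norm1_add: "norm1 (p + q) \<le> norm1 p + norm1 q"
proof -
  let ?S = "Poly_Mapping.keys p \<union> Poly_Mapping.keys q"
  have "norm1 (p + q) = (\<Sum>k\<in>?S. \<bar>Poly_Mapping.lookup (p + q) k\<bar>)"
    by (rule norm1_superset) (auto simp: keys_add)
  also have "\<dots> \<le> (\<Sum>k\<in>?S. \<bar>Poly_Mapping.lookup p k\<bar> + \<bar>Poly_Mapping.lookup q k\<bar>)"
    by (intro sum_mono) (simp add: lookup_add abs_triangle_ineq)
  also have "\<dots> = norm1 p + norm1 q"
    by (simp add: sum.distrib norm1_superset[of ?S])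
  finally show ?thesis .
qed

lemma norm1_sum: "norm1 (\<Sum>i\<in>A. h i) \<le> (\<Sum>i\<in>A. norm1 (h i))"
  by (induction A rule: infinite_finite_induct) (auto intro: order_trans[OF norm1_add])

lemma norm1_single: "norm1 (Poly_Mapping.single k c) = \<bar>c\<bar>"
  by (cases "c = 0") (auto simp: norm1_def)

lemma norm1_one [simp]: "norm1 (1 :: ('a::zero) \<Rightarrow>\<^sub>0 int) = 1"
  using norm1_single[of 0 1] by simp

text \<open>Submultiplicativity is what lets the decay of several factors of a product be multiplied
  together.\<close>

lemma norm1_mult:
  fixes p q :: "'a::monoid_add \<Rightarrow>\<^sub>0 int"
  shows "norm1 (p * q) \<le> norm1 p * norm1 q"
proof -
  have "norm1 (p * q) \<le> (\<Sum>k\<in>Poly_Mapping.keys p. \<Sum>l\<in>Poly_Mapping.keys q.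
      \<bar>Poly_Mapping.lookup p k\<bar> * \<bar>Poly_Mapping.lookup q l\<bar>)"
    unfolding poly_mapping_mult_sum[of p q]
    by (rule order_trans[OF norm1_sum] sum_mono)+ (simp add: norm1_single abs_mult)
  also have "\<dots> = norm1 p * norm1 q"
    by (simp add: norm1_def sum_product)
  finally show ?thesis .
qed

lemma norm1_power:
  fixes p :: "'a::monoid_add \<Rightarrow>\<^sub>0 int"
  shows "norm1 (p ^ n) \<le> norm1 p ^ n"
proof (induction n)
  case (Suc n)
  have "norm1 (p ^ Suc n) \<le> norm1 p * norm1 (p ^ n)"
    by (simp add: norm1_mult)
  also have "\<dots> \<le> norm1 p * norm1 p ^ n"
    by (intro mult_left_mono Suc norm1_nonneg)
  finally show ?case by simp
qed simp

lemma sum_abs_lookup_le_norm1: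
  assumes "finite S"
  shows "(\<Sum>k\<in>S. \<bar>Poly_Mapping.lookup h k\<bar>) \<le> norm1 h"
proof -
  have "(\<Sum>k\<in>S. \<bar>Poly_Mapping.lookup h k\<bar>) \<le>
      (\<Sum>k\<in>S \<union> Poly_Mapping.keys h. \<bar>Poly_Mapping.lookup h k\<bar>)"
    using assms by (intro sum_mono2) auto
  also have "\<dots> = norm1 h"
    using assms by (simp add: norm1_superset[of "S \<union> Poly_Mapping.keys h"])
  finally show ?thesis .
qed

section \<open>The augmentation ideal\<close>

abbreviation X :: "'n \<Rightarrow> 'n laurent" where
  "X i \<equiv> mono (unitvec i) - 1"

text \<open>The combinations of the \<open>X i\<close> form an ideal \<open>J\<close>, and the
  exponents k with \<open>mono k - 1\<close> in \<open>J\<close> form a subgroup of Z^d. It contains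
  all unit vectors, hence everything.\<close>

lemma mono_minus_one_in_span:
  fixes k :: "'n::finite \<Rightarrow> int"
  shows "\<exists>q. mono k - 1 = (\<Sum>i\<in>UNIV. X i * q i)"
proof -
  define J :: "'n laurent set" where "J = {a. \<exists>q. a = (\<Sum>i\<in>UNIV. X i * q i)}"
  have J_I: "a \<in> J" if "a = (\<Sum>i\<in>UNIV. X i * q i)" for a q
    using that unfolding J_def by blast
  have J_add: "a + b \<in> J" if "a \<in> J" "b \<in> J" for a b
  proof -
    from that obtain q r where "a = (\<Sum>i\<in>UNIV. X i * q i)" "b = (\<Sum>i\<in>UNIV. X i * r i)"
      by (auto simp: J_def)
    then have "a + b = (\<Sum>i\<in>UNIV. X i * (q i + r i))"
      by (simp add: sum.distrib distrib_left)
    then show ?thesis by (rule J_I)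
  qed
  have J_mult: "c * a \<in> J" if "a \<in> J" for a c
  proof -
    from that obtain q where "a = (\<Sum>i\<in>UNIV. X i * q i)"
      by (auto simp: J_def)
    then have "c * a = (\<Sum>i\<in>UNIV. X i * (c * q i))"
      by (simp add: sum_distrib_left algebra_simps)
    then show ?thesis by (rule J_I)
  qed
  have J_X: "X i \<in> J" for i
  proof -
    have "X i = (\<Sum>j\<in>UNIV. X j * (if j = i then 1 else 0))"
      by (simp add: sum.remove[of UNIV i])
    then show ?thesis by (rule J_I)
  qed
  have step: "mono (k + l) - 1 \<in> J" if "mono k - 1 \<in> J" "mono l - 1 \<in> J" for k l
  proof -
    have "mono (k + l) - 1 = mono k * (mono l - 1) + (mono k - 1)"
      by (simp add: mono_add algebra_simps)
    then show ?thesis using that by (simp only: J_add J_mult)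
  qed
  have minus: "mono (- k) - 1 \<in> J" if "mono k - 1 \<in> J" for k
  proof -
    have "mono (- k) * mono k = 1"
      by (metis mono_add mono_zero add.left_inverse)
    then have "mono (- k) - 1 = - mono (- k) * (mono k - 1)"
      by (simp add: algebra_simps)
    then show ?thesis using that by (simp only: J_mult)
  qed
  have J_zero: "mono 0 - 1 \<in> J"
    using J_mult[OF J_X, of 0] by (simp add: mono_zero)
  have nat_mult: "mono (\<lambda>j. int m * unitvec i j) - 1 \<in> J" for m i
  proof (induction m)
    case 0
    then show ?case using J_zero by (simp add: zero_fun_def)
  next
    case (Suc m)
    have "(\<lambda>j. int (Suc m) * unitvec i j) = (\<lambda>j. int m * unitvec i j) + unitvec i"
      by (auto simp: fun_eq_iff algebra_simps)
    then show ?case using step[OF Suc J_X] by simp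
  qed
  have int_mult: "mono (\<lambda>j. c * unitvec i j) - 1 \<in> J" for c i
  proof (cases "c \<ge> 0")
    case True
    then show ?thesis using nat_mult[of "nat c" i] by simp
  next
    case False
    then have "(\<lambda>j. c * unitvec i j) = - (\<lambda>j. int (nat (- c)) * unitvec i j)"
      by (auto simp: fun_eq_iff)
    then show ?thesis using minus[OF nat_mult[of "nat (- c)" i]] by simp
  qed
  have "mono (\<lambda>j. \<Sum>i\<in>A. k i * unitvec i j) - 1 \<in> J" if "finite A" for A
    using that
  proof (induction A)
    case empty
    then show ?case using J_zero by (simp add: zero_fun_def)
  next
    case (insert a A)
    have "(\<lambda>j. \<Sum>i\<in>insert a A. k i * unitvec i j) =
        (\<lambda>j. k a * unitvec a j) + (\<lambda>j. \<Sum>i\<in>A. k i * unitvec i j)"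
      using insert by (auto simp: fun_eq_iff)
    then show ?case using step[OF int_mult insert.IH] by simp
  qed
  moreover have "(\<lambda>j. \<Sum>i\<in>UNIV. k i * unitvec i j) = k"
    by (simp add: fun_eq_iff unitvec_def if_distrib[of "\<lambda>x. _ * x"] cong: if_cong)
  ultimately have "mono k - 1 \<in> J"
    by (metis finite)
  then show ?thesis by (auto simp: J_def)
qed

text \<open>Apply the previous lemma to every monomial of h. This is a Taylor expansion of order one
  at the point (1,...,1): it shows that the \<open>X i\<close> generate the augmentation ideal, and
  it can be iterated on the \<open>q i\<close>.\<close>

lemma laurent_decompose:
  fixes h :: "('n::finite) laurent"
  shows "\<exists>q. h = of_int (eval_one h) + (\<Sum>i\<in>UNIV. X i * q i)"
proof -
  have "\<forall>k :: 'n \<Rightarrow> int. \<exists>q. mono k - 1 = (\<Sum>i\<in>UNIV. X i * q i)"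
    by (intro allI mono_minus_one_in_span)
  then obtain q where q: "\<And>k :: 'n \<Rightarrow> int. mono k - 1 = (\<Sum>i\<in>UNIV. X i * q k i)"
    by (auto dest!: choice)
  let ?c = "\<lambda>k. of_int (Poly_Mapping.lookup h k) :: 'n laurent"
  let ?K = "Poly_Mapping.keys h"
  have single: "Poly_Mapping.single k c = of_int c * mono k" for k :: "'n \<Rightarrow> int" and c
  proof -
    have "Poly_Mapping.single 0 (of_int c :: int) = (of_int c :: 'n laurent)"
      by (rule single_of_int)
    then have "(of_int c :: 'n laurent) = Poly_Mapping.single 0 c"
      unfolding of_int_eq_id id_apply by (rule sym)
    then show ?thesis by (simp add: mono_def mult_single del: single_of_int)
  qed
  have "h = (\<Sum>k\<in>?K. ?c k * mono k)"
    using poly_mapping_sum_singles[of h] by (simp add: single)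
  also have "\<dots> = (\<Sum>k\<in>?K. ?c k + ?c k * (mono k - 1))"
    by (rule sum.cong) (simp_all add: right_diff_distrib)
  also have "\<dots> = of_int (eval_one h) + (\<Sum>k\<in>?K. \<Sum>i\<in>UNIV. ?c k * (X i * q k i))"
  proof -
    have "?c k * (mono k - 1) = (\<Sum>i\<in>UNIV. ?c k * (X i * q k i))" for k
      by (subst q) (simp only: sum_distrib_left)
    then show ?thesis by (simp only: sum.distrib eval_one_def of_int_sum)
  qed
  also have "(\<Sum>k\<in>?K. \<Sum>i\<in>UNIV. ?c k * (X i * q k i))
      = (\<Sum>i\<in>UNIV. X i * (\<Sum>k\<in>?K. ?c k * q k i))"
    by (subst sum.swap) (simp only: sum_distrib_left mult.left_commute)
  finally show ?thesis
    by (rule exI[of _ "\<lambda>i. \<Sum>k\<in>?K. ?c k * q k i"])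
qed

section \<open>Differences of powers of the random walk polynomial\<close>

lemma sum_choose_Suc:
  fixes f :: "nat \<Rightarrow> 'a::comm_semiring_1"
  shows "(\<Sum>k\<le>Suc n. of_nat (Suc n choose k) * f k) =
    (\<Sum>k\<le>n. of_nat (n choose k) * (f k + f (Suc k)))"
proof -
  have "(\<Sum>k\<le>Suc n. of_nat (Suc n choose k) * f k) =
      f 0 + (\<Sum>k\<le>n. of_nat (n choose k) * f (Suc k)) + (\<Sum>k\<le>n. of_nat (n choose Suc k) * f (Suc k))"
    by (subst sum.atMost_Suc_shift) (simp add: distrib_right sum.distrib add.assoc)
  also have "\<dots> = (f 0 + (\<Sum>k\<le>n. of_nat (n choose Suc k) * f (Suc k)))
      + (\<Sum>k\<le>n. of_nat (n choose k) * f (Suc k))"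
    by (simp only: add_ac)
  also have "f 0 + (\<Sum>k\<le>n. of_nat (n choose Suc k) * f (Suc k)) = (\<Sum>k\<le>Suc n. of_nat (n choose k) * f k)"
    by (subst sum.atMost_Suc_shift) simp
  also have "\<dots> = (\<Sum>k\<le>n. of_nat (n choose k) * f k)"
    by (simp add: binomial_eq_0)
  finally show ?thesis
    by (simp add: distrib_left sum.distrib add.commute)
qed

text \<open>Variance of a fair walk with steps +1 and -1, whose position after n steps is 2k - n.
  One more step replaces s^2 by (s-1)^2 + (s+1)^2 = 2 s^2 + 2, which drives the induction.\<close>

lemma sum_choose_centered_square:
  "(\<Sum>k\<le>n. real (n choose k) * (2 * real k - real n)\<^sup>2) = real n * 2 ^ n"
proof (induction n)
  case (Suc n)
  have "(\<Sum>k\<le>Suc n. real (Suc n choose k) * (2 * real k - real (Suc n))\<^sup>2) =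
      (\<Sum>k\<le>n. real (n choose k) * (2 * (2 * real k - real n)\<^sup>2 + 2))"
    unfolding sum_choose_Suc
    by (intro sum.cong refl arg_cong2[of _ _ _ _ "(*)"]) (simp add: power2_eq_square algebra_simps)
  also have "\<dots> = 2 * (\<Sum>k\<le>n. real (n choose k) * (2 * real k - real n)\<^sup>2) + 2 * real (\<Sum>k\<le>n. n choose k)"
    by (simp add: distrib_left sum.distrib sum_distrib_left mult_ac)
  finally show ?case
    unfolding Suc choose_row_sum by (simp add: algebra_simps)
qed simp

text \<open>Cauchy-Schwarz against the total mass 2^n turns the variance n into a mean deviation of
  at most sqrt n.\<close>

lemma sum_choose_centered_abs:
  "(\<Sum>k\<le>n. real (n choose k) * \<bar>2 * real k - real n\<bar>) \<le> sqrt (real n) * 2 ^ n"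
proof (rule power2_le_imp_le)
  have "(\<Sum>k\<le>n. sqrt (real (n choose k)) * (sqrt (real (n choose k)) * \<bar>2 * real k - real n\<bar>))\<^sup>2
      \<le> (\<Sum>k\<le>n. (sqrt (real (n choose k)))\<^sup>2) *
        (\<Sum>k\<le>n. (sqrt (real (n choose k)) * \<bar>2 * real k - real n\<bar>)\<^sup>2)"
    by (rule Cauchy_Schwarz_ineq_sum)
  also have "\<dots> = real (\<Sum>k\<le>n. n choose k) * (\<Sum>k\<le>n. real (n choose k) * (2 * real k - real n)\<^sup>2)"
    by (simp add: power_mult_distrib)
  also have "\<dots> = (sqrt (real n) * 2 ^ n)\<^sup>2"
    unfolding sum_choose_centered_square choose_row_sum
    by (simp add: power_mult_distrib power2_eq_square)
  finally show "(\<Sum>k\<le>n. real (n choose k) * \<bar>2 * real k - real n\<bar>)\<^sup>2 \<le> (sqrt (real n) * 2 ^ n)\<^sup>2"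
    by (simp flip: mult.assoc)
qed simp

text \<open>Up to the factor (x+1)^m this is the mean of 1/sqrt(J+1) for a binomial J with m trials
  and success probability 1/(x+1). The mean of 1/(J+1) can be summed by absorbing j+1 into the
  binomial coefficient, and Cauchy-Schwarz passes to the square root. It is used with x = d - 1,
  where J counts the steps in one fixed direction.\<close>

lemma sum_choose_div_sqrt_le:
  fixes x :: real
  assumes "x \<ge> 0"
  shows "(\<Sum>j\<le>m. real (m choose j) * x ^ (m - j) / sqrt (real (Suc j)))
    \<le> sqrt (x + 1) * (x + 1) ^ m / sqrt (real (Suc m))"
proof (rule power2_le_imp_le)
  define p where "p j = real (m choose j) * x ^ (m - j)" for j
  have p: "p j \<ge> 0" for j
    using assms by (simp add: p_def)
  have sum_p: "(\<Sum>j\<le>m. p j) = (x + 1) ^ m"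
    unfolding p_def add.commute[of x 1] binomial_ring by simp
  have "(\<Sum>j\<le>m. p j / real (Suc j)) = (\<Sum>j\<le>m. real (Suc m choose Suc j) * x ^ (Suc m - Suc j)) / real (Suc m)"
    unfolding sum_divide_distrib
  proof (rule sum.cong[OF refl])
    fix j
    have "real (Suc j) * real (Suc m choose Suc j) = real (Suc m) * real (m choose j)"
      by (metis Suc_times_binomial of_nat_mult)
    then have "real (m choose j) / real (Suc j) = real (Suc m choose Suc j) / real (Suc m)"
      by (simp add: divide_simps mult.commute del: of_nat_Suc binomial_Suc_Suc)
    then show "p j / real (Suc j) = real (Suc m choose Suc j) * x ^ (Suc m - Suc j) / real (Suc m)"
      by (simp add: p_def mult.commute[of _ "x ^ _"] del: of_nat_Suc binomial_Suc_Suc flip: times_divide_eq_right)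
  qed
  \<comment> \<open>Restoring the missing nonnegative term j = 0 completes the binomial expansion of
    \<open>(x + 1) ^ Suc m\<close>.\<close>
  also have "\<dots> \<le> (\<Sum>j\<le>Suc m. real (Suc m choose j) * x ^ (Suc m - j)) / real (Suc m)"
    unfolding sum.atMost_Suc_shift using assms
    by (intro divide_right_mono) (simp_all del: binomial_Suc_Suc)
  also have "(\<Sum>j\<le>Suc m. real (Suc m choose j) * x ^ (Suc m - j)) = (x + 1) ^ Suc m"
    unfolding add.commute[of x 1] binomial_ring by simp
  finally have sum_q: "(\<Sum>j\<le>m. p j / real (Suc j)) \<le> (x + 1) ^ Suc m / real (Suc m)" .
  have "(\<Sum>j\<le>m. sqrt (p j) * sqrt (p j / real (Suc j)))\<^sup>2
      \<le> (\<Sum>j\<le>m. (sqrt (p j))\<^sup>2) * (\<Sum>j\<le>m. (sqrt (p j / real (Suc j)))\<^sup>2)"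
    by (rule Cauchy_Schwarz_ineq_sum)
  also have "\<dots> = (x + 1) ^ m * (\<Sum>j\<le>m. p j / real (Suc j))"
    using p sum_p by simp
  also have "\<dots> \<le> (x + 1) ^ m * ((x + 1) ^ Suc m / real (Suc m))"
    using assms by (intro mult_left_mono sum_q) auto
  also have "\<dots> = (sqrt (x + 1) * (x + 1) ^ m / sqrt (real (Suc m)))\<^sup>2"
    using assms by (simp add: power_divide power_mult_distrib) (simp add: power2_eq_square)
  also have "(\<lambda>j. sqrt (p j) * sqrt (p j / real (Suc j))) = (\<lambda>j. p j / sqrt (real (Suc j)))"
    using p by (simp add: fun_eq_iff real_sqrt_divide)
  finally show "(\<Sum>j\<le>m. real (m choose j) * x ^ (m - j) / sqrt (real (Suc j)))\<^sup>2
    \<le> (sqrt (x + 1) * (x + 1) ^ m / sqrt (real (Suc m)))\<^sup>2"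
    by (simp add: p_def)
qed (use assms in simp)

lemma lookup_of_nat_mult: "Poly_Mapping.lookup (of_nat c * h) k = int c * Poly_Mapping.lookup h k"
  by (induction c) (simp_all add: distrib_right lookup_add)

lemma norm1_of_nat_mult: "norm1 (of_nat c * h) = int c * norm1 h"
proof -
  have "Poly_Mapping.keys (of_nat c * h) \<subseteq> Poly_Mapping.keys h"
    by (auto simp: in_keys_iff lookup_of_nat_mult)
  then have "norm1 (of_nat c * h) = (\<Sum>k\<in>Poly_Mapping.keys h. \<bar>Poly_Mapping.lookup (of_nat c * h) k\<bar>)"
    by (intro norm1_superset) auto
  then show ?thesis
    by (simp add: lookup_of_nat_mult abs_mult norm1_def sum_distrib_left)
qed

lemma norm1_of_int_mult: "norm1 (of_int c * h) = \<bar>c\<bar> * norm1 h"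
proof (cases "c \<ge> 0")
  case True
  then show ?thesis using norm1_of_nat_mult[of "nat c" h] by simp
next
  case False
  have "norm1 (of_int c * h) = norm1 (- (of_nat (nat (- c)) * h))"
    using False by simp
  also have "\<dots> = norm1 (of_nat (nat (- c)) * h)"
    by (simp add: norm1_def)
  finally show ?thesis using norm1_of_nat_mult[of "nat (- c)" h] False by simp
qed

lemma norm1_mono [simp]: "norm1 (mono k) = 1"
  by (simp add: mono_def norm1_single)

text \<open>The coefficient of u^k on the left comes from C(n,k-1) - C(n,k) = C(n+1,k)
  (2k-n-1)/(n+1). Clearing the denominator makes the identity meaningful in any commutative ring and
  exhibits the centered deviation 2k-(n+1).\<close>

lemma binomial_difference:
  fixes u :: "'a::comm_ring_1"
  shows "of_nat (Suc n) * ((u - 1) * (1 + u) ^ n) =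
    (\<Sum>k\<le>Suc n. of_int (int (Suc n choose k) * (2 * int k - int (Suc n))) * u ^ k)"
proof -
  have pow: "(\<Sum>k\<le>n. of_nat (n choose k) * u ^ k) = (1 + u) ^ n" for n
    by (subst add.commute[of 1 u]) (simp add: binomial_ring)
  \<comment> \<open>The identity combines the binomial theorem with its derivative.\<close>
  have "(\<Sum>k\<le>Suc n. of_nat (Suc n choose k) * of_nat k * u ^ k) =
      (\<Sum>k\<le>n. of_nat (Suc k * (Suc n choose Suc k)) * u ^ Suc k)"
    by (subst sum.atMost_Suc_shift) (simp add: mult_ac del: binomial_Suc_Suc of_nat_Suc mult_Suc)
  also have "\<dots> = of_nat (Suc n) * u * (\<Sum>k\<le>n. of_nat (n choose k) * u ^ k)"
    unfolding Suc_times_binomial of_nat_mult by (simp add: sum_distrib_left mult_ac del: of_nat_Suc)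
  finally have deriv: "(\<Sum>k\<le>Suc n. of_nat (Suc n choose k) * of_nat k * u ^ k) =
      of_nat (Suc n) * u * (1 + u) ^ n"
    by (simp only: pow)
  have "(\<Sum>k\<le>Suc n. of_int (int (Suc n choose k) * (2 * int k - int (Suc n))) * u ^ k) =
      (\<Sum>k\<le>Suc n. 2 * (of_nat (Suc n choose k) * of_nat k * u ^ k)
        - of_nat (Suc n) * (of_nat (Suc n choose k) * u ^ k))"
    by (rule sum.cong) (simp_all add: algebra_simps del: binomial_Suc_Suc of_nat_Suc)
  also have "\<dots> = 2 * (of_nat (Suc n) * u * (1 + u) ^ n) - of_nat (Suc n) * (1 + u) ^ Suc n"
    unfolding sum_subtractf sum_distrib_left[symmetric] deriv pow ..
  also have "\<dots> = of_nat (Suc n) * ((u - 1) * (1 + u) ^ n)"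
    by (simp add: algebra_simps)
  finally show ?thesis by simp
qed

text \<open>Through \<open>binomial_difference\<close> the norm becomes a mean deviation for n+1
  steps, of order sqrt(n+1), divided by the n+1 that cleared the denominators.\<close>

lemma norm1_difference_binomial:
  fixes k :: "'n \<Rightarrow> int"
  shows "real_of_int (norm1 ((mono k - 1) * (1 + mono k) ^ n)) \<le> 2 ^ Suc n / sqrt (real (Suc n))"
proof -
  let ?h = "(mono k - 1) * (1 + mono k) ^ n"
  have pow: "norm1 (mono k ^ l) \<le> 1" for l
    using norm1_power[of "mono k" l] by simp
  have "int (Suc n) * norm1 ?h = norm1 (of_nat (Suc n) * ?h)"
    by (simp only: norm1_of_nat_mult)
  also have "\<dots> \<le> (\<Sum>l\<le>Suc n. norm1 (of_int (int (Suc n choose l) * (2 * int l - int (Suc n))) * mono k ^ l))"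
    unfolding binomial_difference by (rule norm1_sum)
  also have "\<dots> \<le> (\<Sum>l\<le>Suc n. int (Suc n choose l) * \<bar>2 * int l - int (Suc n)\<bar>)"
  proof (rule sum_mono)
    fix l
    have "norm1 (of_int (int (Suc n choose l) * (2 * int l - int (Suc n))) * mono k ^ l)
        = int (Suc n choose l) * \<bar>2 * int l - int (Suc n)\<bar> * norm1 (mono k ^ l)"
      unfolding norm1_of_int_mult by (simp add: abs_mult)
    also have "\<dots> \<le> int (Suc n choose l) * \<bar>2 * int l - int (Suc n)\<bar> * 1"
      by (intro mult_left_mono pow) simp
    finally show "norm1 (of_int (int (Suc n choose l) * (2 * int l - int (Suc n))) * mono k ^ l)
        \<le> int (Suc n choose l) * \<bar>2 * int l - int (Suc n)\<bar>" by simp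
  qed
  finally have "real_of_int (int (Suc n) * norm1 ?h) \<le>
      real_of_int (\<Sum>l\<le>Suc n. int (Suc n choose l) * \<bar>2 * int l - int (Suc n)\<bar>)"
    by (simp only: of_int_le_iff)
  also have "\<dots> = (\<Sum>l\<le>Suc n. real (Suc n choose l) * \<bar>2 * real l - real (Suc n)\<bar>)"
    unfolding of_int_sum by (rule sum.cong) (simp_all del: binomial_Suc_Suc)
  also have "\<dots> \<le> sqrt (real (Suc n)) * 2 ^ Suc n"
    by (rule sum_choose_centered_abs)
  finally have le: "real (Suc n) * real_of_int (norm1 ?h) \<le> sqrt (real (Suc n)) * 2 ^ Suc n"
    by (simp del: of_nat_Suc)
  have "real_of_int (norm1 ?h) = real (Suc n) * real_of_int (norm1 ?h) / real (Suc n)"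
    by (simp del: of_nat_Suc)
  also have "\<dots> \<le> sqrt (real (Suc n)) * 2 ^ Suc n / real (Suc n)"
    by (intro divide_right_mono le) simp
  also have "\<dots> = 2 ^ Suc n * (sqrt (real (Suc n)) / real (Suc n))"
    by simp
  also have "sqrt (real (Suc n)) / real (Suc n) = 1 / sqrt (real (Suc n))"
    by (metis real_divide_square_eq real_sqrt_mult_self mult_1_left abs_of_nonneg of_nat_0_le_iff inverse_eq_divide sqrt_divide_self_eq)
  finally show ?thesis by simp
qed

section \<open>Decay of differences of the lazy random walk\<close>

definition walk :: "('n::finite) laurent" where
  "walk = (\<Sum>i\<in>UNIV. mono (- unitvec i) * (1 + mono (unitvec i))\<^sup>2)"

text \<open>Each factored summand expands to 2 + u_i + u_i^(-1). The factored form serves the norm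
  estimates, this one the Fourier side, where it gives the multiplier 4d - F.\<close>

lemma walk_eq: "walk = of_nat (4 * CARD('n)) - (fd :: 'n::finite laurent)"
proof -
  have eq: "mono (- unitvec i) * (1 + mono (unitvec i))\<^sup>2 = 2 + (mono (unitvec i) + mono (- unitvec i))"
    for i :: 'n
  proof -
    have inv: "mono (- unitvec i) * mono (unitvec i) = 1"
      by (metis mono_add mono_zero add.left_inverse)
    have "mono (- unitvec i) * (1 + mono (unitvec i))\<^sup>2 =
      mono (- unitvec i) + 2 * (mono (- unitvec i) * mono (unitvec i))
        + (mono (- unitvec i) * mono (unitvec i)) * mono (unitvec i)"
      by (simp add: power2_eq_square algebra_simps)
    then show ?thesis unfolding inv by simp
  qed
  show ?thesis
    unfolding walk_def fd_def eq by (simp add: sum.distrib algebra_simps)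
qed

text \<open>Isolate direction i: \<open>walk = P + R\<close>, where only \<open>P\<close> interacts
  with \<open>X i\<close>. In the binomial expansion the j steps taken in direction i give decay
  1/sqrt(j+1), the other directions contribute at most (4(d-1))^(m-j), and
  \<open>sum_choose_div_sqrt_le\<close> averages over j.\<close>

lemma norm1_X_walk_power:
  fixes i :: "'n::finite"
  shows "real_of_int (norm1 (X i * walk ^ m)) \<le>
    2 * sqrt CARD('n) * (4 * CARD('n)) ^ m / sqrt (Suc m)"
proof -
  let ?u = "mono (unitvec i)" and ?v = "mono (- unitvec i)"
  define d where "d = real CARD('n)"
  have d: "d \<ge> 1" by (simp add: d_def Suc_leI)
  define P :: "'n laurent" where "P = ?v * (1 + ?u)\<^sup>2"
  define R :: "'n laurent" where
    "R = (\<Sum>j\<in>UNIV - {i}. mono (- unitvec j) * (1 + mono (unitvec j))\<^sup>2)"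
  have walk: "walk = P + R"
    unfolding walk_def P_def R_def by (rule sum.remove) auto
  have norm_term: "norm1 (mono (- unitvec j) * (1 + mono (unitvec j))\<^sup>2) \<le> 4" for j :: 'n
  proof -
    have "norm1 (1 + mono (unitvec j)) \<le> 2"
      using norm1_add[of 1 "mono (unitvec j)"] by simp
    then have "norm1 (1 + mono (unitvec j)) ^ 2 \<le> 2 ^ 2"
      by (intro power_mono norm1_nonneg)
    then show ?thesis
      using norm1_mult[of "mono (- unitvec j)" "(1 + mono (unitvec j))\<^sup>2"]
        norm1_power[of "1 + mono (unitvec j)" 2] by simp
  qed
  have "norm1 R \<le> (\<Sum>j\<in>UNIV - {i}. 4)"
    unfolding R_def by (rule order_trans[OF norm1_sum]) (intro sum_mono norm_term)
  also have "\<dots> = 4 * (int CARD('n) - 1)"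
    by (simp add: card_Diff_singleton_if of_nat_diff Suc_leI)
  finally have "real_of_int (norm1 R) \<le> real_of_int (4 * (int CARD('n) - 1))"
    by (simp only: of_int_le_iff)
  then have R: "real_of_int (norm1 R) \<le> 4 * (d - 1)"
    by (simp add: d_def)
  have P: "real_of_int (norm1 (X i * P ^ j)) \<le> 2 * 4 ^ j / sqrt (Suc j)" for j
  proof -
    \<comment> \<open>The monomial \<open>?v ^ j\<close> only translates coefficients, so j steps of
      \<open>P\<close> act like the power 2j of 1 + u_i.\<close>
    have eq: "X i * P ^ j = ?v ^ j * (X i * (1 + ?u) ^ (2 * j))"
      unfolding P_def power_mult_distrib power_mult by (simp only: mult_ac)
    have "norm1 (X i * P ^ j) \<le> norm1 (?v ^ j) * norm1 (X i * (1 + ?u) ^ (2 * j))"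
      unfolding eq by (rule norm1_mult)
    also have "\<dots> \<le> 1 * norm1 (X i * (1 + ?u) ^ (2 * j))"
      using norm1_power[of ?v j] by (intro mult_right_mono norm1_nonneg) simp
    finally have "real_of_int (norm1 (X i * P ^ j)) \<le> real_of_int (norm1 (X i * (1 + ?u) ^ (2 * j)))"
      by simp
    also have "\<dots> \<le> 2 ^ Suc (2 * j) / sqrt (Suc (2 * j))"
      by (rule norm1_difference_binomial)
    \<comment> \<open>The weaker denominator is the one that the averaging lemma handles.\<close>
    also have "\<dots> \<le> 2 ^ Suc (2 * j) / sqrt (Suc j)"
      by (intro divide_left_mono) auto
    finally show ?thesis by (simp add: power_mult)
  qed
  have "norm1 (X i * walk ^ m) = norm1 (\<Sum>j\<le>m. of_nat (m choose j) * ((X i * P ^ j) * R ^ (m - j)))"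
    unfolding walk binomial_ring by (simp add: sum_distrib_left mult_ac)
  also have "\<dots> \<le> (\<Sum>j\<le>m. norm1 (of_nat (m choose j) * ((X i * P ^ j) * R ^ (m - j))))"
    by (rule norm1_sum)
  finally have "real_of_int (norm1 (X i * walk ^ m)) \<le>
      real_of_int (\<Sum>j\<le>m. norm1 (of_nat (m choose j) * ((X i * P ^ j) * R ^ (m - j))))"
    by (simp only: of_int_le_iff)
  also have "\<dots> = (\<Sum>j\<le>m. real (m choose j) * real_of_int (norm1 ((X i * P ^ j) * R ^ (m - j))))"
    by (simp add: norm1_of_nat_mult)
  also have "\<dots> \<le> (\<Sum>j\<le>m. 2 * 4 ^ m * (real (m choose j) * (d - 1) ^ (m - j) / sqrt (Suc j)))"
  proof (rule sum_mono)
    fix j assume "j \<in> {..m}"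
    then have m: "(4::real) ^ m = 4 ^ j * 4 ^ (m - j)"
      by (simp flip: power_add)
    have "real_of_int (norm1 (R ^ (m - j))) \<le> real_of_int (norm1 R) ^ (m - j)"
      using norm1_power[of R "m - j"] by (simp only: of_int_le_iff flip: of_int_power)
    also have "\<dots> \<le> (4 * (d - 1)) ^ (m - j)"
      by (intro power_mono R) (simp add: norm1_nonneg)
    finally have R': "real_of_int (norm1 (R ^ (m - j))) \<le> (4 * (d - 1)) ^ (m - j)" .
    have "real_of_int (norm1 ((X i * P ^ j) * R ^ (m - j))) \<le>
        real_of_int (norm1 (X i * P ^ j)) * real_of_int (norm1 (R ^ (m - j)))"
      using norm1_mult[of "X i * P ^ j" "R ^ (m - j)"] by (simp only: of_int_le_iff flip: of_int_mult)
    also have "\<dots> \<le> (2 * 4 ^ j / sqrt (Suc j)) * (4 * (d - 1)) ^ (m - j)"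
      by (intro mult_mono P R') (simp_all add: norm1_nonneg)
    finally have "real (m choose j) * real_of_int (norm1 ((X i * P ^ j) * R ^ (m - j))) \<le>
        real (m choose j) * ((2 * 4 ^ j / sqrt (Suc j)) * (4 * (d - 1)) ^ (m - j))"
      by (rule mult_left_mono) simp
    also have "\<dots> = 2 * 4 ^ m * (real (m choose j) * (d - 1) ^ (m - j) / sqrt (Suc j))"
      unfolding m power_mult_distrib[of 4 "d - 1"] by simp
    finally show "real (m choose j) * real_of_int (norm1 ((X i * P ^ j) * R ^ (m - j))) \<le>
        2 * 4 ^ m * (real (m choose j) * (d - 1) ^ (m - j) / sqrt (Suc j))" .
  qed
  also have "\<dots> = 2 * 4 ^ m * (\<Sum>j\<le>m. real (m choose j) * (d - 1) ^ (m - j) / sqrt (Suc j))"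
    by (rule sum_distrib_left [symmetric])
  also have "\<dots> \<le> 2 * 4 ^ m * (sqrt (d - 1 + 1) * (d - 1 + 1) ^ m / sqrt (Suc m))"
    using d by (intro mult_left_mono sum_choose_div_sqrt_le) auto
  also have "\<dots> = 2 * sqrt CARD('n) * (4 * CARD('n)) ^ m / sqrt (Suc m)"
    by (simp add: d_def power_mult_distrib)
  finally show ?thesis .
qed

lemma norm1_XXX_walk_power:
  fixes i j k :: "'n::finite"
  shows "real_of_int (norm1 (X i * X j * X k * walk ^ m)) \<le>
    (2 * sqrt CARD('n)) ^ 3 * 3 powr (3 / 2) * (4 * CARD('n)) ^ m * real (Suc m) powr (- 3 / 2)"
proof -
  define q where "q = m div 3"
  define C where "C = 2 * sqrt (real CARD('n))"
  define D where "D = 4 * real CARD('n)"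
  \<comment> \<open>The third exponent takes the remainder of the division by 3, so all three
    exponents are at least \<open>q\<close>.\<close>
  define r where "r = m - 2 * q"
  have r: "q \<le> r" "m = q + q + r"
    by (auto simp: q_def r_def)
  have pos: "C \<ge> 0" "D \<ge> 0" by (simp_all add: C_def D_def)
  have *: "real_of_int (norm1 (X i * walk ^ l)) \<le> C * D ^ l / sqrt (Suc q)" if "q \<le> l" for i :: 'n and l
  proof -
    have "real_of_int (norm1 (X i * walk ^ l)) \<le> C * D ^ l / sqrt (Suc l)"
      using norm1_X_walk_power[of i l] by (simp add: C_def D_def)
    also have "\<dots> \<le> C * D ^ l / sqrt (Suc q)"
      using that pos by (intro divide_left_mono) auto
    finally show ?thesis .
  qed
  have eq: "X i * X j * X k * walk ^ m = (X i * walk ^ q) * ((X j * walk ^ q) * (X k * walk ^ r))"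
    unfolding r(2) power_add by (simp add: mult_ac)
  have "norm1 (X i * X j * X k * walk ^ m) \<le>
      norm1 (X i * walk ^ q) * (norm1 (X j * walk ^ q) * norm1 (X k * walk ^ r))"
    unfolding eq
    by (rule order_trans[OF norm1_mult]) (intro mult_left_mono norm1_mult norm1_nonneg)
  then have "real_of_int (norm1 (X i * X j * X k * walk ^ m)) \<le>
      real_of_int (norm1 (X i * walk ^ q)) * (real_of_int (norm1 (X j * walk ^ q)) * real_of_int (norm1 (X k * walk ^ r)))"
    by (simp only: of_int_le_iff flip: of_int_mult)
  also have "\<dots> \<le> (C * D ^ q / sqrt (Suc q)) * ((C * D ^ q / sqrt (Suc q)) * (C * D ^ r / sqrt (Suc q)))"
    using pos r by (intro mult_mono * mult_nonneg_nonneg) (auto simp: norm1_nonneg)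
  also have "\<dots> = C ^ 3 * D ^ m * (1 / sqrt (Suc q)) ^ 3"
    unfolding r(2) power_add power3_eq_cube by (simp only: divide_inverse mult_1_left mult_ac)
  also have "\<dots> \<le> C ^ 3 * D ^ m * (3 powr (3 / 2) * real (Suc m) powr (- 3 / 2))"
  proof (intro mult_left_mono)
    \<comment> \<open>Source of the constant 3 powr (3/2): each of the three factors decays like
      (m/3)^(-1/2).\<close>
    have "Suc m \<le> 3 * Suc q"
      unfolding q_def by simp
    then have "real (Suc m) \<le> 3 * real (Suc q)"
      by linarith
    then have "(real (Suc m) / 3) powr (3 / 2) \<le> real (Suc q) powr (3 / 2)"
      by (intro powr_mono2) auto
    moreover have "sqrt (real (Suc q)) ^ 3 = real (Suc q) powr (3 / 2)"
      by (simp add: powr_half_sqrt[symmetric] powr_power del: of_nat_Suc)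
    ultimately have "(1 / sqrt (Suc q)) ^ 3 \<le> 1 / (real (Suc m) / 3) powr (3 / 2)"
      by (simp add: power_divide divide_simps del: of_nat_Suc)
    also have "\<dots> = 3 powr (3 / 2) * real (Suc m) powr (- 3 / 2)"
      by (simp add: powr_divide powr_minus divide_simps del: of_nat_Suc)
    finally show "(1 / sqrt (Suc q)) ^ 3 \<le> 3 powr (3 / 2) * real (Suc m) powr (- 3 / 2)" .
  qed (use pos in auto)
  finally show ?thesis
    by (simp add: C_def D_def mult_ac)
qed

section \<open>Fourier transform on the torus\<close>

text \<open>Lebesgue measure on \<open>real^'n\<close> is the image of a product measure indexed by
  \<open>Basis\<close>. Fubini for finite products therefore applies once indices are carried along
  the bijection \<open>ax\<close> with inverse \<open>ix\<close>.\<close>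

lemma integral_lborel_vec_prod:
  fixes f :: "'n::finite \<Rightarrow> real \<Rightarrow> 'a::{real_normed_field,banach,second_countable_topology}"
  assumes f: "\<And>i. integrable lborel (f i)"
  shows "integrable lborel (\<lambda>t::real^'n. \<Prod>i\<in>UNIV. f i (t $ i))"
    and "(\<integral>t. (\<Prod>i\<in>UNIV. f i (t $ i)) \<partial>lborel) = (\<Prod>i\<in>UNIV. (\<integral>x. f i x \<partial>lborel))"
proof -
  interpret product_sigma_finite "\<lambda>_::real^'n. lborel :: real measure"
    by standard
  define ax :: "'n \<Rightarrow> real^'n" where "ax i = axis i 1" for i
  define ix where "ix b = (THE i. b = ax i)" for b
  have ix: "ix (ax i) = i" for i
    unfolding ix_def ax_def by (auto simp: axis_eq_axis)
  have Basis: "(Basis :: (real^'n) set) = range ax"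
    by (auto simp: Basis_vec_def ax_def)
  have inj: "inj ax"
    by (metis injI ix)
  let ?P = "\<Pi>\<^sub>M b\<in>(Basis :: (real^'n) set). lborel :: real measure"
  let ?T = "\<lambda>g. \<Sum>b\<in>(Basis :: (real^'n) set). g b *\<^sub>R b"
  have [measurable]: "f i \<in> borel_measurable borel" for i
    using borel_measurable_integrable[OF f[of i]] by simp
  have T: "?T \<in> measurable ?P borel"
    by measurable
  have meas: "(\<lambda>t::real^'n. \<Prod>i\<in>UNIV. f i (t $ i)) \<in> borel_measurable borel"
    by measurable
  have "?T g $ i = g (ax i)" for g i
  proof -
    have "?T g $ i = ?T g \<bullet> ax i"
      by (simp add: ax_def inner_axis)
    also have "\<dots> = g (ax i)"
      by (subst inner_sum_left_Basis) (auto simp: Basis)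
    finally show ?thesis .
  qed
  then have comp: "(\<Prod>i\<in>UNIV. f i (?T g $ i)) = (\<Prod>b\<in>Basis. f (ix b) (g b))" for g
    unfolding Basis by (simp add: prod.reindex[OF inj] ix)
  show "integrable lborel (\<lambda>t::real^'n. \<Prod>i\<in>UNIV. f i (t $ i))"
    unfolding lborel_eq[where 'a = "real^'n"]
    by (subst integrable_distr_eq[OF T meas], subst comp) (rule product_integrable_prod; simp add: f)
  have "(\<integral>t. (\<Prod>i\<in>UNIV. f i ((t::real^'n) $ i)) \<partial>lborel) = (\<integral>g. (\<Prod>b\<in>Basis. f (ix b) (g b)) \<partial>?P)"
    unfolding lborel_eq[where 'a = "real^'n"]
    by (subst integral_distr[OF T meas], subst comp) (rule refl)
  also have "\<dots> = (\<Prod>b\<in>(Basis :: (real^'n) set). (\<integral>x. f (ix b) x \<partial>lborel))"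
    by (rule product_integral_prod) (simp_all add: f)
  also have "\<dots> = (\<Prod>i\<in>UNIV. (\<integral>x. f i x \<partial>lborel))"
    unfolding Basis by (simp add: prod.reindex[OF inj] ix)
  finally show "(\<integral>t. (\<Prod>i\<in>UNIV. f i ((t::real^'n) $ i)) \<partial>lborel) = (\<Prod>i\<in>UNIV. (\<integral>x. f i x \<partial>lborel))" .
qed

lemma mem_unit_cube: "t \<in> cbox 0 (One :: real^'n) \<longleftrightarrow> (\<forall>i::'n::finite. 0 \<le> t $ i \<and> t $ i \<le> 1)"
proof -
  have "(One :: real^'n) $ i = 1" for i
  proof -
    have "axis i (1::real) \<in> Basis"
      by (auto simp: Basis_vec_def)
    then have "(\<Sum>b\<in>Basis. 1 *\<^sub>R b) \<bullet> axis i (1::real) = 1"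
      by (rule inner_sum_left_Basis)
    then show ?thesis by (simp add: inner_axis)
  qed
  then show ?thesis by (simp add: mem_box_cart)
qed

lemma indicator_unit_cube:
  "indicator (cbox 0 (One :: real^'n)) t = (\<Prod>i\<in>UNIV. indicator {0..1} (t $ (i::'n::finite)) :: real)"
proof (cases "t \<in> cbox 0 (One :: real^'n)")
  case True
  then show ?thesis by (simp add: mem_unit_cube)
next
  case False
  then obtain i where "t $ i \<notin> {0..1}"
    by (auto simp: mem_unit_cube)
  then have "(\<Prod>i\<in>UNIV. indicator {0..1} (t $ i) :: real) = 0"
    by (intro prod_zero bexI[of _ i]) (auto simp: indicator_def)
  then show ?thesis using False by simp
qed

lemma AE_vec_nth_neq:
  fixes c :: real
  shows "AE t::real^'n::finite in lborel. t $ i \<noteq> c"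
proof -
  have "{t::real^'n. t $ i = c} \<in> null_sets lebesgue"
    using negligible_standard_hyperplane[of "axis i 1 :: real^'n" c]
    by (auto simp: negligible_iff_null_sets inner_axis Basis_vec_def)
  moreover have "{t::real^'n. t $ i = c} \<in> sets lborel"
    by measurable
  ultimately have "{t::real^'n. t $ i = c} \<in> null_sets lborel"
    by (simp add: null_sets_completion_iff)
  then show ?thesis
    by (rule AE_I') auto
qed

section \<open>Characters of the torus and transforms of Laurent polynomials\<close>

lemma lat_inner_add: "lat_inner (k + l) t = lat_inner k t + lat_inner l t"
  by (simp add: lat_inner_def distrib_right sum.distrib)

lemma lat_inner_uminus: "lat_inner (- k) t = - lat_inner k t"
  by (simp add: lat_inner_def sum_negf)

lemma lat_inner_diff: "lat_inner (k - l) t = lat_inner k t - lat_inner l t"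
  by (simp add: lat_inner_def left_diff_distrib sum_subtractf)

lemma lat_inner_zero [simp]: "lat_inner 0 t = 0"
  by (simp add: lat_inner_def)

lemma lat_inner_zero_right [simp]: "lat_inner k 0 = 0"
  by (simp add: lat_inner_def)

lemma lat_inner_unitvec [simp]: "lat_inner (unitvec i) t = t $ i"
  by (simp add: lat_inner_def unitvec_def if_distrib[of "\<lambda>x. real_of_int x * _"] if_distrib[of "\<lambda>x. x * _"] cong: if_cong)

lemma continuous_on_lat_inner [continuous_intros]:
  "continuous_on A f \<Longrightarrow> continuous_on A (\<lambda>x. lat_inner k (f x))"
  unfolding lat_inner_def by (intro continuous_intros)

lemma continuous_on_cis [continuous_intros]:
  "continuous_on A f \<Longrightarrow> continuous_on A (\<lambda>x. cis (f x))"
  unfolding cis_conv_exp by (intro continuous_intros)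

text \<open>The exponent has the sign opposite to that in \<open>wd\<close>. Hence integration
  against the characters of \<open>wd\<close> recovers coefficients, and acting by h multiplies the
  integrand of \<open>wd\<close> by \<open>fhat h\<close>.\<close>

definition fhat :: "('n::finite) laurent \<Rightarrow> real^'n \<Rightarrow> complex" where
  "fhat h t = pairing h (\<lambda>k. cis (2 * pi * lat_inner k t))"

lemma fhat_add: "fhat (p + q) t = fhat p t + fhat q t"
  by (simp add: fhat_def pairing_add)

lemma fhat_diff: "fhat (p - q) t = fhat p t - fhat q t"
  by (simp add: fhat_def pairing_diff)

lemma fhat_sum: "fhat (\<Sum>i\<in>A. h i) t = (\<Sum>i\<in>A. fhat (h i) t)"
  by (simp add: fhat_def pairing_sum)

lemma fhat_one [simp]: "fhat 1 t = 1"
  by (simp add: fhat_def pairing_one)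

lemma fhat_zero [simp]: "fhat 0 t = 0"
  by (simp add: fhat_def)

lemma fhat_mono: "fhat (mono k) t = cis (2 * pi * lat_inner k t)"
  by (simp add: fhat_def pairing_mono)

lemma pairing_cmult: "pairing h (\<lambda>k. a * \<phi> k) = a * pairing h \<phi>"
  by (simp add: pairing_def sum_distrib_left mult.left_commute)

lemma pairing_multc: "pairing h (\<lambda>k. \<phi> k * a) = pairing h \<phi> * a"
  by (simp add: pairing_def sum_distrib_right mult.assoc)

lemma fhat_mult: "fhat (p * q) t = fhat p t * fhat q t"
  unfolding fhat_def pairing_mult
  by (simp add: lat_inner_add distrib_left pairing_cmult pairing_multc flip: cis_mult)

lemma fhat_power: "fhat (p ^ m) t = fhat p t ^ m"
  by (induction m) (simp_all add: fhat_mult)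

lemma fhat_of_nat [simp]: "fhat (of_nat m) t = of_nat m"
  by (induction m) (simp_all add: fhat_add)

lemma fhat_numeral [simp]: "fhat (numeral m) t = numeral m"
  using fhat_of_nat[of "numeral m" t] by simp

lemma fhat_uminus: "fhat (- p) t = - fhat p t"
  by (simp add: fhat_def pairing_uminus)

lemma fhat_of_int [simp]: "fhat (of_int m) t = of_int m"
  by (cases m) (simp_all add: fhat_uminus del: of_nat_Suc)

lemma fhat_X: "fhat (X i) t = cis (2 * pi * t $ i) - 1"
  by (simp add: fhat_diff fhat_mono)

lemma eval_one_eq_fhat: "of_int (eval_one h) = fhat h 0"
  by (simp add: eval_one_def fhat_def pairing_def)

lemma pairing_const: "pairing h (\<lambda>_. c) = of_int (eval_one h) * c"
  by (simp add: eval_one_def pairing_def sum_distrib_right)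

lemma continuous_on_fhat [continuous_intros]:
  "continuous_on A f \<Longrightarrow> continuous_on A (\<lambda>x. fhat h (f x))"
  unfolding fhat_def pairing_def by (intro continuous_intros)

lemma Fd_eq_sum: "Fd t = (\<Sum>i\<in>UNIV. 2 - 2 * cos (2 * pi * t $ i))"
  by (simp add: Fd_def sum_subtractf sum_distrib_left)

lemma norm_fhat_X: "(norm (fhat (X i) t))\<^sup>2 = 2 - 2 * cos (2 * pi * t $ i)"
proof -
  have "(norm (fhat (X i) t))\<^sup>2 = (cos (2 * pi * t $ i) - 1)\<^sup>2 + (sin (2 * pi * t $ i))\<^sup>2"
    by (simp add: fhat_X cmod_power2)
  also have "\<dots> = 2 - 2 * cos (2 * pi * t $ i)"
    using sin_cos_squared_add[of "2 * pi * t $ i"] by (simp add: power2_eq_square algebra_simps)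
  finally show ?thesis .
qed

text \<open>F is the sum of the squared moduli of the transforms of all \<open>X i\<close>, so each
  generator of the augmentation ideal has a transform of size at most sqrt F.\<close>

lemma norm_fhat_X_le: "(norm (fhat (X i) t))\<^sup>2 \<le> Fd t"
  unfolding norm_fhat_X Fd_eq_sum by (rule member_le_sum) (auto intro: cos_le_one)

lemma Fd_nonneg: "0 \<le> Fd t"
  using norm_fhat_X_le[of undefined t] zero_le_power2 order_trans by blast

lemma Fd_le: "Fd (t :: real^'n) \<le> 4 * CARD('n::finite)"
proof -
  have "Fd t \<le> (\<Sum>i\<in>(UNIV :: 'n set). 4)"
    unfolding Fd_eq_sum
  proof (rule sum_mono)
    fix i show "2 - 2 * cos (2 * pi * t $ i) \<le> 4"
      using cos_ge_minus_one[of "2 * pi * t $ i"] by linarith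
  qed
  then show ?thesis by simp
qed

lemma fhat_fd: "fhat fd t = of_real (Fd t)"
proof -
  have "fhat (mono (unitvec i)) t + fhat (mono (- unitvec i)) t = of_real (2 * cos (2 * pi * t $ i))" for i
    by (simp add: fhat_mono lat_inner_uminus complex_eq_iff)
  then show ?thesis
    by (simp add: fd_def fhat_diff fhat_mult fhat_sum fhat_add Fd_def sum_distrib_left)
qed

lemma continuous_on_Fd [continuous_intros]:
  "continuous_on A f \<Longrightarrow> continuous_on A (\<lambda>x. Fd (f x))"
  using continuous_on_Re[OF continuous_on_fhat[of A f fd]] by (simp add: fhat_fd)

lemma fhat_walk: "fhat (walk :: 'n::finite laurent) t = of_real (4 * CARD('n) - Fd t)"
  by (simp add: walk_eq fhat_diff fhat_mult fhat_fd)

lemma integral_cis: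
  "(\<integral>x. indicator {0..1} x *\<^sub>R cis (2 * pi * real_of_int m * x) \<partial>lborel) = (if m = 0 then 1 else 0)"
proof (cases "m = 0")
  case True
  have "(\<integral>x. indicator {0..1::real} x *\<^sub>R (1 :: complex) \<partial>lborel) = 1"
    by simp
  then show ?thesis using True by simp
next
  case False
  define c :: complex where "c = 2 * pi * of_int m * \<i>"
  have c: "c \<noteq> 0" using False by (simp add: c_def)
  have cis: "cis (2 * pi * real_of_int m * x) = exp (c * of_real x)" for x
    by (simp add: cis_conv_exp c_def mult_ac)
  have "(\<integral>x. indicator {0..1} x *\<^sub>R cis (2 * pi * real_of_int m * x) \<partial>lborel)
      = exp (c * of_real 1) / c - exp (c * of_real 0) / c"
    unfolding cis
  proof (rule integral_FTC_atLeastAtMost)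
    fix x
    have "((\<lambda>z. exp (c * z) / c) has_field_derivative exp (c * of_real x)) (at (of_real x))"
      using c by (auto intro!: derivative_eq_intros)
    then show "((\<lambda>x. exp (c * of_real x) / c) has_vector_derivative exp (c * of_real x)) (at x within {0..1})"
      by (rule has_vector_derivative_real_field)
  qed (auto intro!: continuous_intros)
  also have "\<dots> = 0"
    using cis_multiple_2pi[of "real_of_int m"] cis[of 1] by simp
  finally show ?thesis using False by simp
qed

lemma set_integrable_character: "set_integrable lborel (cbox 0 (One :: real^'n::finite)) (\<lambda>t. cis (2 * pi * lat_inner k t))"
  unfolding set_integrable_def by (intro borel_integrable_compact) (auto intro!: continuous_intros)

lemma integral_character:
  "(LINT t:cbox 0 (One :: real^'n::finite)|lborel. cis (2 * pi * lat_inner k t)) = (if k = 0 then 1 else 0)"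
proof -
  let ?f = "\<lambda>i x. indicator {0..1} x *\<^sub>R cis (2 * pi * real_of_int (k i) * x)"
  have int: "integrable lborel (?f i)" for i
    by (intro borel_integrable_compact) (auto intro!: continuous_intros)
  have cis: "cis (sum g A) = (\<Prod>i\<in>A. cis (g i))" if "finite A" for g and A :: "'n set"
    using that by (induction A) (simp_all add: cis_mult[symmetric])
  have "indicator (cbox 0 (One :: real^'n)) t *\<^sub>R cis (2 * pi * lat_inner k t) = (\<Prod>i\<in>UNIV. ?f i (t $ i))" for t
    by (simp add: indicator_unit_cube scaleR_conv_of_real prod.distrib lat_inner_def sum_distrib_left cis mult_ac)
  then have "(LINT t:cbox 0 (One :: real^'n::finite)|lborel. cis (2 * pi * lat_inner k t)) = (\<Prod>i\<in>UNIV. (\<integral>x. ?f i x \<partial>lborel))"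
    unfolding set_lebesgue_integral_def by (simp only: integral_lborel_vec_prod(2)[OF int])
  also have "\<dots> = (\<Prod>i\<in>UNIV. if k i = 0 then 1 else 0)"
    by (simp only: integral_cis)
  also have "\<dots> = (if k = 0 then 1 else 0)"
    by (auto simp: fun_eq_iff)
  finally show ?thesis .
qed

lemma integral_fhat:
  fixes h :: "('n::finite) laurent"
  shows "(LINT t:cbox 0 One|lborel. cis (- 2 * pi * lat_inner n t) * fhat h t) = of_int (Poly_Mapping.lookup h n)"
proof -
  let ?K = "Poly_Mapping.keys h"
  have "(LINT t:cbox 0 One|lborel. cis (- 2 * pi * lat_inner n t) * fhat h t) =
      (LINT t:cbox 0 (One :: real^'n)|lborel. (\<Sum>k\<in>?K. of_int (Poly_Mapping.lookup h k) * cis (2 * pi * lat_inner (k - n) t)))"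
    by (simp add: fhat_def pairing_def sum_distrib_left lat_inner_diff right_diff_distrib cis_divide[symmetric]
      cis_mult mult_ac minus_mult_left[symmetric] cis_inverse[symmetric] divide_inverse del: cis_inverse)
  also have "\<dots> = (\<Sum>k\<in>?K. of_int (Poly_Mapping.lookup h k) * (if k - n = 0 then 1 else 0))"
    using set_integrable_character[where 'n = 'n]
    by (simp add: set_lebesgue_integral_def scaleR_sum_right set_integrable_def
      Bochner_Integration.integral_sum integral_character[unfolded set_lebesgue_integral_def]
      flip: mult_scaleR_right)
  also have "\<dots> = of_int (Poly_Mapping.lookup h n)"
    by (simp add: if_distrib[of "\<lambda>x. _ * x"] in_keys_iff cong: if_cong)
  finally show ?thesis .
qed

section \<open>Integrability of the Green kernel\<close>

text \<open>A polynomial minorant symmetric under x -> 1 - x, chosen because its negative powers are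
  Beta integrands. By that symmetry the interval [0, 1/2] is enough.\<close>

lemma sin_pi_lower:
  fixes x :: real
  assumes "0 \<le> x" "x \<le> 1"
  shows "x * (1 - x) \<le> sin (pi * x)"
proof -
  have half: "x \<le> sin (pi * x)" if x: "0 \<le> x" "x \<le> 1 / 2" for x :: real
  proof -
    define z where "z = pi * x"
    \<comment> \<open>From 3 < pi < 4. With z <= 2 the cubic Taylor bound z - z^3/6 is at least z/3,
      and z/3 is at least x.\<close>
    have z: "0 \<le> z" "z \<le> 2" "3 * x \<le> z"
      using x pi_gt3 pi_less_4 mult_mono[of pi 4 x "1/2"] mult_right_mono[of 3 pi x] by (auto simp: z_def)
    have "\<bar>sin z - (\<Sum>m<3. sin_coeff m * z ^ m)\<bar> \<le> inverse (fact 3) * \<bar>z\<bar> ^ 3"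
      by (rule Maclaurin_sin_bound)
    then have "\<bar>sin z - z\<bar> * 6 \<le> z ^ 3"
      using z by (simp add: eval_nat_numeral sin_coeff_def)
    moreover have "z - sin z \<le> \<bar>sin z - z\<bar>"
      by simp
    ultimately have "sin z \<ge> z - z ^ 3 / 6"
      by simp
    moreover have "z ^ 3 \<le> 4 * z"
      using mult_right_mono[OF mult_mono[OF z(2) z(2)], of z] z by (simp add: power3_eq_cube)
    ultimately show ?thesis using z unfolding z_def by linarith
  qed
  show ?thesis
  proof (cases "x \<le> 1 / 2")
    case True
    have "x * (1 - x) \<le> x"
      using assms by (simp add: mult_left_le)
    then show ?thesis using half[OF assms(1) True] by linarith
  next
    case False
    have "x * (1 - x) \<le> 1 - x"
      using assms by (simp add: mult_left_le_one_le)
    also have "\<dots> \<le> sin (pi * (1 - x))"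
      using False assms by (intro half) auto
    also have "\<dots> = sin (pi * x)"
      by (simp add: right_diff_distrib)
    finally show ?thesis .
  qed
qed

lemma Fd_lower:
  assumes "t \<in> cbox 0 (One :: real^'n)"
  shows "4 * (t $ i * (1 - t $ (i::'n::finite)))\<^sup>2 \<le> Fd t"
proof -
  have t: "0 \<le> t $ i" "t $ i \<le> 1"
    using assms by (auto simp: mem_unit_cube)
  have "4 * (t $ i * (1 - t $ i))\<^sup>2 \<le> 4 * (sin (pi * t $ i))\<^sup>2"
    using sin_pi_lower[OF t] t by (intro mult_left_mono power_mono) auto
  also have "\<dots> = 2 - 2 * cos (2 * (pi * t $ i))"
    by (simp add: cos_double_sin)
  also have "\<dots> \<le> Fd t"
    using norm_fhat_X_le[of i t] unfolding norm_fhat_X by (simp add: mult.assoc)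
  finally show ?thesis .
qed

lemma norm_fhat_le: "norm (fhat h t) \<le> real_of_int (norm1 h)"
proof -
  have "norm (fhat h t) \<le> (\<Sum>k\<in>Poly_Mapping.keys h. norm (of_int (Poly_Mapping.lookup h k) * cis (2 * pi * lat_inner k t)))"
    unfolding fhat_def pairing_def by (rule norm_sum)
  then show ?thesis by (simp add: norm_mult norm1_def)
qed

lemma norm_fhat_X_le_sqrt: "norm (fhat (X i) t) \<le> sqrt (Fd t)"
  by (rule real_le_rsqrt) (rule norm_fhat_X_le)

text \<open>The left side is the transform of \<open>mono k - 1\<close>, a combination of the
  \<open>X i\<close>. For d = 2 this shows that the subtracted 1 in \<open>wd\<close> cancels half
  of the singularity of 1/F.\<close>

lemma norm_cis_minus_one_le:
  fixes k :: "'n::finite \<Rightarrow> int"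
  shows "\<exists>L. \<forall>t. norm (cis (2 * pi * lat_inner k t) - 1) \<le> L * sqrt (Fd t)"
proof -
  obtain q where q: "mono k - 1 = (\<Sum>i\<in>UNIV. X i * q i)"
    using mono_minus_one_in_span[of k] by blast
  have "norm (cis (2 * pi * lat_inner k t) - 1) \<le> (\<Sum>i\<in>UNIV. real_of_int (norm1 (q i))) * sqrt (Fd t)" for t
  proof -
    have "cis (2 * pi * lat_inner k t) - 1 = fhat (mono k - 1) t"
      by (simp add: fhat_diff fhat_mono)
    also have "\<dots> = (\<Sum>i\<in>UNIV. fhat (X i) t * fhat (q i) t)"
      unfolding q by (simp only: fhat_sum fhat_mult)
    also have "norm \<dots> \<le> (\<Sum>i\<in>UNIV. sqrt (Fd t) * real_of_int (norm1 (q i)))"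
      by (rule sum_norm_le)
        (auto simp only: norm_mult intro!: mult_mono norm_fhat_le norm_fhat_X_le_sqrt norm_ge_zero real_sqrt_ge_zero Fd_nonneg)
    finally show ?thesis by (simp add: sum_distrib_left sum_distrib_right mult.commute)
  qed
  then show ?thesis by blast
qed

text \<open>A product of Beta(1/3,1/3) integrands. The exponent 2/3 is below 1, which gives
  integrability, and is just large enough for d = 3, where the three exponents add up to the order 2
  of the zero of F.\<close>

definition weight :: "real^'n::finite \<Rightarrow> real" where
  "weight t = (\<Prod>i\<in>UNIV. (t $ i) powr (- 2 / 3) * (1 - t $ i) powr (- 2 / 3))"

lemma set_integrable_weight: "set_integrable lborel (cbox 0 One) weight"
proof -
  have "integrable lborel (\<lambda>x::real. indicator {0..1} x *\<^sub>R (x powr (- 2 / 3) * (1 - x) powr (- 2 / 3)))"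
    using integrable_Beta[of "1 / 3" "1 / 3"] by (simp add: set_integrable_def)
  then have "integrable lborel (\<lambda>t::real^'n. \<Prod>i\<in>UNIV. indicator {0..1} (t $ i) *\<^sub>R
      ((t $ i) powr (- 2 / 3) * (1 - t $ i) powr (- 2 / 3)))"
    by (rule integral_lborel_vec_prod(1))
  then show ?thesis
    by (simp add: set_integrable_def weight_def indicator_unit_cube prod.distrib)
qed

text \<open>With M the largest of the numbers t_i (1 - t_i), all of them at most 1, the product of their powers
  with exponent 2/3 is at most M powr (2d/3), which bounds both 1/F (for d at least 3) and the square root of 1/F (for d = 2)
  by an integrable product.\<close>

lemma inverse_weight_le:
  fixes t :: "real^'n::finite"
  assumes t: "\<And>i. 0 < t $ i" "\<And>i. t $ i < 1"
  obtains M where "0 < M" "M \<le> 1" "4 * M\<^sup>2 \<le> Fd t" "1 \<le> weight t * M powr (2 / 3 * real CARD('n))"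
proof
  define y where "y i = t $ i * (1 - t $ i)" for i
  define M where "M = Max (range y)"
  have y: "0 < y i" "y i \<le> 1" for i
    using t[of i] by (auto simp: y_def intro!: mult_le_one)
  have "M \<in> range y" unfolding M_def by (rule Max_in) auto
  then obtain i where i: "M = y i" by auto
  show "0 < M" "M \<le> 1" using y i by auto
  have "t \<in> cbox 0 One" using t by (simp add: mem_unit_cube less_imp_le)
  then show "4 * M\<^sup>2 \<le> Fd t" unfolding i y_def by (rule Fd_lower)
  have "1 = weight t * (\<Prod>i\<in>UNIV. y i powr (2 / 3))"
  proof -
    have "(t $ i) powr (- 2 / 3) * (1 - t $ i) powr (- 2 / 3) = y i powr (- 2 / 3)" for i
      using t[of i] by (simp add: y_def powr_mult)
    moreover have "y i powr (- 2 / 3) * y i powr (2 / 3) = 1" for i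
      using y(1)[of i] by (simp flip: powr_add)
    ultimately show ?thesis
      by (simp add: weight_def flip: prod.distrib)
  qed
  also have "\<dots> \<le> weight t * (\<Prod>i\<in>(UNIV :: 'n set). M powr (2 / 3))"
  proof (intro mult_left_mono prod_mono conjI powr_mono2)
    show "y i \<le> M" for i unfolding M_def by (rule Max_ge) auto
    show "0 \<le> weight t" unfolding weight_def by (intro prod_nonneg) auto
  qed (use y in \<open>auto intro: less_imp_le\<close>)
  also have "(\<Prod>i\<in>(UNIV :: 'n set). M powr (2 / 3)) = M powr (2 / 3 * real CARD('n))"
    using \<open>0 < M\<close> by (simp add: powr_power mult.commute)
  finally show "1 \<le> weight t * M powr (2 / 3 * real CARD('n))" .
qed

lemma weight_nonneg: "0 \<le> weight t"
  unfolding weight_def by (intro prod_nonneg) auto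

text \<open>For d = 2 the numerator is O(sqrt F), so 1/sqrt F remains and 4/3 >= 1 suffices; for d
  >= 3 the full 1/F is controlled because 2d/3 >= 2. Boundary points are excluded because
  \<open>0 powr x\<close> is 0, which makes \<open>weight\<close> vanish there.\<close>

lemma kernel_bound:
  fixes n :: "'n::finite \<Rightarrow> int"
  assumes card: "CARD('n) \<ge> 2"
  shows "\<exists>C. \<forall>t. (\<forall>i. 0 < t $ i \<and> t $ i < 1) \<longrightarrow>
    norm ((cis (- 2 * pi * lat_inner n t) - (if CARD('n) = 2 then 1 else 0)) / of_real (Fd t)) \<le> C * weight t"
proof (cases "CARD('n) = 2")
  case True
  obtain L where L: "\<And>t. norm (cis (2 * pi * lat_inner (- n) t) - 1) \<le> L * sqrt (Fd t)"
    using norm_cis_minus_one_le[of "- n"] by blast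
  have "norm ((cis (- 2 * pi * lat_inner n t) - 1) / of_real (Fd t)) \<le> (\<bar>L\<bar> / 2) * weight t"
    if t: "\<forall>i. 0 < t $ i \<and> t $ i < 1" for t
  proof -
    obtain M where M: "0 < M" "M \<le> 1" "4 * M\<^sup>2 \<le> Fd t" "1 \<le> weight t * M powr (2 / 3 * real CARD('n))"
      using inverse_weight_le[of t] t by blast
    have F: "Fd t > 0" using M(1,3) zero_less_power[OF M(1), of 2] by linarith
    have "2 * M = sqrt (4 * M\<^sup>2)"
      using M(1) by (simp add: real_sqrt_mult)
    also have "\<dots> \<le> sqrt (Fd t)"
      using M(3) by (rule real_sqrt_le_mono)
    finally have sqrt: "2 * M \<le> sqrt (Fd t)" .
    have "M powr (2 / 3 * real CARD('n)) \<le> M powr 1"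
      unfolding True using M by (intro powr_mono') auto
    then have "1 \<le> weight t * M"
      using M(1,4) mult_left_mono[OF _ weight_nonneg[of t]] by fastforce
    have "norm ((cis (- 2 * pi * lat_inner n t) - 1) / of_real (Fd t)) =
        norm (cis (2 * pi * lat_inner (- n) t) - 1) / Fd t"
      using F by (simp add: norm_divide lat_inner_uminus)
    also have "\<dots> \<le> \<bar>L\<bar> * sqrt (Fd t) / Fd t"
      using L[of t] F by (intro divide_right_mono) (auto intro: order_trans mult_right_mono)
    also have "\<dots> = \<bar>L\<bar> * (1 / sqrt (Fd t))"
      using F by (simp add: field_simps)
    also have "\<dots> \<le> \<bar>L\<bar> * (weight t * M / (2 * M))"
      using \<open>1 \<le> weight t * M\<close> sqrt M(1) weight_nonneg[of t]
      by (intro mult_left_mono frac_le) auto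
    finally show ?thesis using M(1) by simp
  qed
  then show ?thesis using True by (intro exI[of _ "\<bar>L\<bar> / 2"]) simp
next
  case False
  have "norm (cis (- 2 * pi * lat_inner n t) / of_real (Fd t)) \<le> (1 / 4) * weight t"
    if t: "\<forall>i. 0 < t $ i \<and> t $ i < 1" for t
  proof -
    obtain M where M: "0 < M" "M \<le> 1" "4 * M\<^sup>2 \<le> Fd t" "1 \<le> weight t * M powr (2 / 3 * real CARD('n))"
      using inverse_weight_le[of t] t by blast
    have F: "Fd t > 0" using M(1,3) zero_less_power[OF M(1), of 2] by linarith
    have "M powr (2 / 3 * real CARD('n)) \<le> M powr 2"
      using M False card by (intro powr_mono') auto
    then have "1 \<le> weight t * M\<^sup>2"
      using M(1,4) mult_left_mono[OF _ weight_nonneg[of t]] by fastforce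
    have "norm (cis (- 2 * pi * lat_inner n t) / of_real (Fd t)) = 1 / Fd t"
      using F by (simp add: norm_divide)
    also have "\<dots> \<le> weight t * M\<^sup>2 / (4 * M\<^sup>2)"
      using \<open>1 \<le> weight t * M\<^sup>2\<close> M weight_nonneg[of t] by (intro frac_le) auto
    finally show ?thesis using M(1) by simp
  qed
  then show ?thesis using False by (intro exI[of _ "1 / 4"]) simp
qed

lemma AE_cube_interior:
  "AE t::real^'n::finite in lborel. t \<in> cbox 0 One \<longrightarrow> (\<forall>i. 0 < t $ i \<and> t $ i < 1)"
proof -
  have "AE t::real^'n in lborel. \<forall>i. t $ i \<noteq> 0 \<and> t $ i \<noteq> 1"
    by (simp add: AE_all_countable AE_vec_nth_neq)
  then show ?thesis
    by eventually_elim (auto simp: mem_unit_cube less_le)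
qed

lemma AE_Fd_pos: "AE t::real^'n::finite in lborel. t \<in> cbox 0 One \<longrightarrow> Fd t > 0"
  using AE_cube_interior
proof eventually_elim
  case (elim t)
  show ?case
  proof
    assume "t \<in> cbox 0 One"
    with elim have "\<And>i. 0 < t $ i" "\<And>i. t $ i < 1" by auto
    then obtain M where "0 < M" "4 * M\<^sup>2 \<le> Fd t"
      using inverse_weight_le by blast
    then show "Fd t > 0"
      using zero_less_power[of M 2] by linarith
  qed
qed

lemma borel_measurable_kernel:
  "(\<lambda>t::real^'n::finite. (cis (c * lat_inner n t) - a) / of_real (Fd t)) \<in> borel_measurable lborel"
proof -
  have "(\<lambda>t::real^'n. cis (c * lat_inner n t) - a) \<in> borel_measurable lborel"
    "(\<lambda>t::real^'n. complex_of_real (Fd t)) \<in> borel_measurable lborel"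
    by (auto intro!: borel_measurable_continuous_onI continuous_intros)
  then show ?thesis by (rule borel_measurable_divide)
qed

lemma set_integrable_kernel:
  fixes n :: "'n::finite \<Rightarrow> int"
  assumes "CARD('n) \<ge> 2"
  shows "set_integrable lborel (cbox 0 One)
    (\<lambda>t. (cis (- 2 * pi * lat_inner n t) - (if CARD('n) = 2 then 1 else 0)) / of_real (Fd t))"
    (is "set_integrable _ _ ?K")
proof -
  obtain C where C: "\<And>t. \<forall>i. 0 < t $ i \<and> t $ i < 1 \<Longrightarrow> norm (?K t) \<le> C * weight t"
    using kernel_bound[OF assms, of n] by blast
  have "set_integrable lborel (cbox 0 One) (\<lambda>t::real^'n. C * weight t)"
    using set_integrable_weight by (rule set_integrable_mult_right)
  then show ?thesis
  proof (rule set_integrable_bound)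
    show "set_borel_measurable lborel (cbox 0 One) ?K"
      unfolding set_borel_measurable_def
      by (intro borel_measurable_scaleR borel_measurable_kernel) auto
    show "AE t in lborel. t \<in> cbox 0 One \<longrightarrow> norm (?K t) \<le> norm (C * weight t)"
      using AE_cube_interior
    proof eventually_elim
      case (elim t)
      then show ?case using C[of t] by (auto intro: order_trans)
    qed
  qed
qed

text \<open>Moving the case distinction into a subtracted constant allows one argument for all
  dimensions.\<close>

lemma wd_eq:
  "wd (n :: 'n::finite \<Rightarrow> int) = (LINT t:cbox 0 One|lborel.
    (cis (- 2 * pi * lat_inner n t) - (if CARD('n) = 2 then 1 else 0)) / of_real (Fd t))"
  by (simp add: wd_def)

section \<open>Action on the Green function\<close>

lemma pairing_diff_right: "pairing h (\<lambda>k. \<phi> k - \<psi> k) = pairing h \<phi> - pairing h \<psi>"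
  by (simp add: pairing_def right_diff_distrib sum_subtractf)

text \<open>The subtracted constant contributes \<open>eval_one h\<close> times itself, hence
  nothing. From here on d = 2 and d >= 3 look the same.\<close>

lemma act_wd:
  fixes h :: "('n::finite) laurent"
  assumes card: "CARD('n) \<ge> 2" and h: "eval_one h = 0"
  shows "act h wd n = (LINT t:cbox 0 One|lborel. cis (- 2 * pi * lat_inner n t) * fhat h t / of_real (Fd t))"
proof -
  define e :: complex where "e = (if CARD('n) = 2 then 1 else 0)"
  define K where "K n t = (cis (- 2 * pi * lat_inner n t) - e) / of_real (Fd t)" for n :: "'n \<Rightarrow> int" and t
  have int: "set_integrable lborel (cbox 0 One) (K n)" for n
    unfolding K_def e_def using set_integrable_kernel[OF card, of n] .
  have "act h wd n = (\<Sum>k\<in>Poly_Mapping.keys h. of_int (Poly_Mapping.lookup h k) * (LINT t:cbox 0 One|lborel. K (n - k) t))"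
    by (simp add: act_def wd_eq K_def e_def)
  also have "\<dots> = (\<Sum>k\<in>Poly_Mapping.keys h. (\<integral>t. of_int (Poly_Mapping.lookup h k) * (indicator (cbox 0 One) t *\<^sub>R K (n - k) t) \<partial>lborel))"
    by (simp only: set_lebesgue_integral_def integral_mult_right_zero)
  also have "\<dots> = (\<integral>t. (\<Sum>k\<in>Poly_Mapping.keys h. of_int (Poly_Mapping.lookup h k) * (indicator (cbox 0 One) t *\<^sub>R K (n - k) t)) \<partial>lborel)"
    using int by (intro Bochner_Integration.integral_sum[symmetric] integrable_mult_right) (simp add: set_integrable_def)
  also have "\<dots> = (LINT t:cbox 0 One|lborel. pairing h (\<lambda>k. K (n - k) t))"
    by (simp add: set_lebesgue_integral_def pairing_def scaleR_sum_right)
  also have "(\<lambda>t. pairing h (\<lambda>k. K (n - k) t)) = (\<lambda>t. cis (- 2 * pi * lat_inner n t) * fhat h t / of_real (Fd t))"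
  proof
    fix t
    have "cis (- 2 * pi * lat_inner (n - k) t) = cis (- 2 * pi * lat_inner n t) * cis (2 * pi * lat_inner k t)" for k
      by (simp add: cis_mult lat_inner_diff algebra_simps)
    then have "pairing h (\<lambda>k. K (n - k) t) =
        (cis (- 2 * pi * lat_inner n t) * fhat h t - pairing h (\<lambda>_. e)) * inverse (of_real (Fd t))"
      unfolding K_def divide_inverse pairing_multc pairing_diff_right fhat_def by (simp only: pairing_cmult)
    then show "pairing h (\<lambda>k. K (n - k) t) = cis (- 2 * pi * lat_inner n t) * fhat h t / of_real (Fd t)"
      by (simp add: pairing_const h divide_inverse)
  qed
  finally show ?thesis .
qed

lemma Fd_zero: "Fd 0 = 0"
  by (simp add: Fd_def)

lemma eval_one_eq_zero_iff: "eval_one h = 0 \<longleftrightarrow> fhat h 0 = 0"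
  by (simp flip: eval_one_eq_fhat)

text \<open>The transform of \<open>fd\<close> is F itself, which cancels the denominator almost
  everywhere; orthogonality of characters does the rest.\<close>

lemma act_fd_wd:
  fixes n :: "'n::finite \<Rightarrow> int"
  assumes card: "CARD('n) \<ge> 2"
  shows "act fd wd n = (if n = 0 then 1 else 0)"
proof -
  have "act fd wd n = (LINT t:cbox 0 (One::real^'n)|lborel. cis (- 2 * pi * lat_inner n t) * fhat fd t / of_real (Fd t))"
    by (rule act_wd[OF card]) (simp add: eval_one_eq_zero_iff fhat_fd Fd_zero)
  also have "\<dots> = (LINT t:cbox 0 (One::real^'n)|lborel. cis (2 * pi * lat_inner (- n) t))"
    unfolding set_lebesgue_integral_def
  proof (rule integral_cong_AE)
    show "(\<lambda>t::real^'n. indicator (cbox 0 One) t *\<^sub>R (cis (- 2 * pi * lat_inner n t) * fhat fd t / of_real (Fd t)))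
        \<in> borel_measurable lborel"
      by (intro borel_measurable_scaleR borel_measurable_divide)
        (auto intro!: borel_measurable_continuous_onI continuous_intros)
    show "(\<lambda>t::real^'n. indicator (cbox 0 One) t *\<^sub>R cis (2 * pi * lat_inner (- n) t)) \<in> borel_measurable lborel"
      by (intro borel_measurable_scaleR) (auto intro!: borel_measurable_continuous_onI continuous_intros)
    show "AE t::real^'n in lborel.
       indicator (cbox 0 One) t *\<^sub>R (cis (- 2 * pi * lat_inner n t) * fhat fd t / of_real (Fd t)) =
       indicator (cbox 0 One) t *\<^sub>R cis (2 * pi * lat_inner (- n) t)"
      using AE_Fd_pos
      by eventually_elim (auto simp: fhat_fd lat_inner_uminus indicator_def)
  qed
  also have "\<dots> = (if n = 0 then 1 else 0)"
    by (simp add: integral_character)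
  finally show ?thesis .
qed

section \<open>The geometric series for 1/F and membership in I_d\<close>

lemma geometric_remainder:
  fixes F :: real
  assumes "D \<noteq> 0"
  shows "(\<Sum>m<M. (D - F) ^ m / D ^ Suc m) * F = 1 - ((D - F) / D) ^ M"
proof (induction M)
  case (Suc M)
  have "(\<Sum>m<Suc M. (D - F) ^ m / D ^ Suc m) * F = 1 - ((D - F) / D) ^ M + (D - F) ^ M / D ^ Suc M * F"
    by (simp add: distrib_right Suc del: power_Suc)
  also have "\<dots> = 1 - ((D - F) / D) ^ Suc M"
    using assms by (simp add: power_divide field_simps)
  finally show ?case .
qed simp

text \<open>The partial sums of the integrand have modulus |h^| (1 - (1 - F/D)^M)/F, which the
  assumption bounds by \<open>C\<close> uniformly in M. Dominated convergence then moves the limit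
  through the integral, and the coefficients of \<open>h * walk ^ m\<close> appear as Fourier
  integrals.\<close>

lemma act_wd_series:
  fixes h :: "('n::finite) laurent"
  assumes card: "CARD('n) \<ge> 2" and C: "\<And>t. norm (fhat h t) \<le> C * Fd t"
  shows "(\<lambda>M. \<Sum>m<M. of_int (Poly_Mapping.lookup (h * walk ^ m) n) / (4 * CARD('n)) ^ Suc m)
    \<longlonglongrightarrow> act h wd n"
proof -
  define D where "D = 4 * real CARD('n)"
  have D: "D > 0" by (simp add: D_def)
  define s where "s M t = (\<Sum>m<M. cis (- 2 * pi * lat_inner n t) * fhat (h * walk ^ m) t / of_real D ^ Suc m)" for M t
  define g where "g t = cis (- 2 * pi * lat_inner n t) * fhat h t / of_real (Fd t)" for t
  have "C \<ge> 0"
  proof (rule ccontr)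
    assume "\<not> C \<ge> 0"
    obtain t :: "real^'n" where "Fd t > 0"
    proof
      show "Fd (\<chi> i. 1 / 2 :: real^'n) > 0"
        by (simp add: Fd_def)
    qed
    then have "C * Fd t < 0" using \<open>\<not> C \<ge> 0\<close> by (simp add: mult_less_0_iff)
    then show False using C[of t] norm_ge_zero[of "fhat h t"] by linarith
  qed
  have h0: "eval_one h = 0"
    using C[of 0] by (simp add: eval_one_eq_zero_iff Fd_zero)
  have s_eq: "s M t = cis (- 2 * pi * lat_inner n t) * fhat h t * of_real (\<Sum>m<M. (D - Fd t) ^ m / D ^ Suc m)" for M t
    by (simp add: s_def fhat_mult fhat_power fhat_walk D_def sum_distrib_left mult_ac)
  have norm_s: "norm (s M t) \<le> C" and lim_s: "(\<lambda>M. s M t) \<longlonglongrightarrow> g t" for M t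
  proof -
    have *: "norm (s M t) \<le> C \<and> (\<lambda>M. s M t) \<longlonglongrightarrow> g t" for M
    \<comment> \<open>Where F vanishes the assumption forces h^ to vanish, so all partial sums are
      0, and so is \<open>g t\<close>.\<close>
    proof (cases "Fd t = 0")
      case True
      then have "fhat h t = 0" using C[of t] by simp
      then show ?thesis using \<open>C \<ge> 0\<close> by (simp add: s_eq g_def)
    next
      case False
      define F where "F = Fd t"
      have F: "0 < F" "F \<le> D"
        using False Fd_nonneg[of t] Fd_le[of t] by (auto simp: F_def D_def)
      have a: "(\<Sum>m<M. (D - F) ^ m / D ^ Suc m) = (1 - ((D - F) / D) ^ M) / F" for M
        using geometric_remainder[of D F M] D F by (simp add: field_simps)
      have r: "0 \<le> (D - F) / D" "(D - F) / D < 1"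
        using D F by auto
      have "norm (s M t) = norm (fhat h t) * ((1 - ((D - F) / D) ^ M) / F)"
        unfolding s_eq F_def[symmetric] a using r F
        by (simp add: norm_mult norm_divide power_le_one abs_of_nonneg del: of_real_diff of_real_divide of_real_power)
      also have "\<dots> \<le> (C * F) * (1 / F)"
        using C[of t] F r \<open>C \<ge> 0\<close> by (intro mult_mono divide_right_mono) (auto simp: F_def power_le_one)
      finally have 1: "norm (s M t) \<le> C" using F by simp
      have "(\<lambda>M. cis (- 2 * pi * lat_inner n t) * fhat h t * of_real ((1 - ((D - F) / D) ^ M) / F))
          \<longlonglongrightarrow> cis (- 2 * pi * lat_inner n t) * fhat h t * of_real ((1 - 0) / F)"
        using r F by (intro tendsto_intros LIMSEQ_realpow_zero) auto
      then have 2: "(\<lambda>M. s M t) \<longlonglongrightarrow> g t"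
        unfolding s_eq F_def[symmetric] a g_def by (simp add: divide_inverse)
      show ?thesis using 1 2 by blast
    qed
    show "norm (s M t) \<le> C" "(\<lambda>M. s M t) \<longlonglongrightarrow> g t" using * by blast+
  qed
  have "(\<lambda>M. \<integral>t. indicator (cbox 0 (One::real^'n)) t *\<^sub>R s M t \<partial>lborel) \<longlonglongrightarrow> (\<integral>t. indicator (cbox 0 (One::real^'n)) t *\<^sub>R g t \<partial>lborel)"
  proof (rule integral_dominated_convergence)
    show "(\<lambda>t. indicator (cbox 0 (One::real^'n)) t *\<^sub>R g t) \<in> borel_measurable lborel"
      unfolding g_def by (intro borel_measurable_scaleR borel_measurable_divide)
        (auto intro!: borel_measurable_continuous_onI continuous_intros)
    show "(\<lambda>t. indicator (cbox 0 (One::real^'n)) t *\<^sub>R s M t) \<in> borel_measurable lborel" for M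
      unfolding s_def using D by (intro borel_measurable_scaleR)
        (auto intro!: borel_measurable_continuous_onI continuous_intros)
    show "integrable lborel (\<lambda>t. C * indicator (cbox 0 (One::real^'n)) t)"
      by (intro integrable_mult_right integrable_real_indicator) (auto simp: emeasure_lborel_cbox_finite)
    show "AE t in lborel. (\<lambda>M. indicator (cbox 0 (One::real^'n)) t *\<^sub>R s M t) \<longlonglongrightarrow> indicator (cbox 0 (One::real^'n)) t *\<^sub>R g t"
      by (intro always_eventually allI tendsto_intros lim_s)
    show "AE t in lborel. norm (indicator (cbox 0 (One::real^'n)) t *\<^sub>R s M t) \<le> C * indicator (cbox 0 (One::real^'n)) t" for M
      using norm_s by (intro always_eventually allI) (simp add: indicator_def)
  qed
  moreover have "(\<integral>t. indicator (cbox 0 (One::real^'n)) t *\<^sub>R g t \<partial>lborel) = act h wd n"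
    unfolding g_def act_wd[OF card h0] by (simp add: set_lebesgue_integral_def)
  moreover have "(\<integral>t. indicator (cbox 0 (One::real^'n)) t *\<^sub>R s M t \<partial>lborel)
      = (\<Sum>m<M. of_int (Poly_Mapping.lookup (h * walk ^ m) n) / of_real D ^ Suc m)" for M
  proof -
    have int: "integrable lborel (\<lambda>t. indicator (cbox 0 (One::real^'n)) t *\<^sub>R (cis (- 2 * pi * lat_inner n t) * fhat (h * walk ^ m) t))" for m
      by (intro borel_integrable_compact) (auto intro!: continuous_intros)
    have "(\<integral>t. indicator (cbox 0 (One::real^'n)) t *\<^sub>R s M t \<partial>lborel)
       = (\<integral>t. (\<Sum>m<M. (indicator (cbox 0 (One::real^'n)) t *\<^sub>R (cis (- 2 * pi * lat_inner n t) * fhat (h * walk ^ m) t)) / of_real D ^ Suc m) \<partial>lborel)"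
      by (intro Bochner_Integration.integral_cong refl)
        (simp only: s_def scaleR_sum_right scaleR_conv_of_real sum_distrib_left times_divide_eq_right)
    also have "\<dots> = (\<Sum>m<M. (\<integral>t. indicator (cbox 0 (One::real^'n)) t *\<^sub>R (cis (- 2 * pi * lat_inner n t) * fhat (h * walk ^ m) t) \<partial>lborel) / of_real D ^ Suc m)"
      using int by (subst Bochner_Integration.integral_sum) (auto simp del: power_Suc)
    also have "\<dots> = (\<Sum>m<M. of_int (Poly_Mapping.lookup (h * walk ^ m) n) / of_real D ^ Suc m)"
      using integral_fhat[of n "h * walk ^ _"] by (simp add: set_lebesgue_integral_def)
    finally show ?thesis .
  qed
  ultimately show ?thesis
    by (simp add: D_def)
qed

text \<open>The \<open>l^1\<close> norm is lower semicontinuous under pointwise convergence: a bound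
  on partial sums over a finite set, uniform in the set and in M, survives the limit M to
  infinity.\<close>

lemma Id_setI:
  fixes h :: "('n::finite) laurent"
  assumes card: "CARD('n) \<ge> 2" and C: "\<And>t. norm (fhat h t) \<le> C * Fd t"
    and summable: "summable (\<lambda>m. real_of_int (norm1 (h * walk ^ m)) / (4 * CARD('n)) ^ Suc m)"
  shows "h \<in> Id_set"
proof -
  define b where "b m = real_of_int (norm1 (h * walk ^ m)) / (4 * CARD('n)) ^ Suc m" for m
  have b: "b m \<ge> 0" for m by (simp add: b_def norm1_nonneg)
  have "(\<Sum>n\<in>S. norm (act h wd n)) \<le> suminf b" if S: "finite S" for S
  proof (rule LIMSEQ_le_const2)
    let ?a = "\<lambda>M n. \<Sum>m<M. of_int (Poly_Mapping.lookup (h * walk ^ m) n) / (4 * CARD('n)) ^ Suc m :: complex"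
    show "(\<lambda>M. \<Sum>n\<in>S. norm (?a M n)) \<longlonglongrightarrow> (\<Sum>n\<in>S. norm (act h wd n))"
      by (intro tendsto_sum tendsto_norm act_wd_series[OF card C])
    show "\<exists>N. \<forall>M\<ge>N. (\<Sum>n\<in>S. norm (?a M n)) \<le> suminf b"
    proof (intro exI allI impI)
      fix M
      have "(\<Sum>n\<in>S. norm (?a M n)) \<le>
          (\<Sum>n\<in>S. \<Sum>m<M. real_of_int \<bar>Poly_Mapping.lookup (h * walk ^ m) n\<bar> / (4 * CARD('n)) ^ Suc m)"
        unfolding norm_of_real
        by (intro sum_mono order_trans[OF sum_abs]) (simp add: abs_divide)
      also have "\<dots> = (\<Sum>m<M. real_of_int (\<Sum>n\<in>S. \<bar>Poly_Mapping.lookup (h * walk ^ m) n\<bar>) / (4 * CARD('n)) ^ Suc m)"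
        by (subst sum.swap) (simp add: sum_divide_distrib)
      also have "\<dots> \<le> (\<Sum>m<M. b m)"
        unfolding b_def
        by (intro sum_mono divide_right_mono)
          (simp_all only: of_int_le_iff sum_abs_lookup_le_norm1[OF S] of_nat_0_le_iff)
      also have "\<dots> \<le> suminf b"
        using summable b unfolding b_def by (intro sum_le_suminf) auto
      finally show "(\<Sum>n\<in>S. norm (?a M n)) \<le> suminf b" .
    qed
  qed
  then have "(\<lambda>n. norm (act h wd n)) summable_on UNIV"
    by (intro nonneg_bdd_above_summable_on) (auto simp: bdd_above_def)
  then show ?thesis by (simp add: Id_set_def)
qed

text \<open>The transform is at most F^(3/2), and F <= 4d turns this into a multiple of F, as the
  series needs. Summability is that of m^(-3/2); \<open>K\<close> also absorbs the extra 4d in the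
  denominator.\<close>

lemma XXX_in_Id_set:
  fixes i j k :: "'n::finite"
  assumes card: "CARD('n) \<ge> 2"
  shows "X i * X j * X k \<in> Id_set"
proof (rule Id_setI[OF card])
  fix t :: "real^'n"
  have "norm (fhat (X i * X j * X k) t) \<le> sqrt (Fd t) * sqrt (Fd t) * sqrt (Fd t)"
    unfolding fhat_mult norm_mult
    by (intro mult_mono norm_fhat_X_le_sqrt) (auto simp: Fd_nonneg)
  also have "\<dots> = sqrt (Fd t) * Fd t"
    using Fd_nonneg[of t] by simp
  also have "\<dots> \<le> sqrt (4 * CARD('n)) * Fd t"
    using Fd_le[of t] Fd_nonneg[of t] by (intro mult_right_mono) auto
  finally show "norm (fhat (X i * X j * X k) t) \<le> sqrt (4 * CARD('n)) * Fd t" .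
next
  define K where "K = (2 * sqrt CARD('n)) ^ 3 * 3 powr (3 / 2) / (4 * CARD('n))"
  have "summable (\<lambda>m. real m powr (- 3 / 2))"
    by (simp add: summable_real_powr_iff)
  then have "summable (\<lambda>m. K * real (Suc m) powr (- 3 / 2))"
    by (intro summable_mult) (subst summable_Suc_iff[of "\<lambda>m. real m powr (- 3 / 2)"])
  then show "summable (\<lambda>m. real_of_int (norm1 (X i * X j * X k * walk ^ m)) / (4 * CARD('n)) ^ Suc m)"
  proof (rule summable_comparison_test'[where N = 0])
    fix m :: nat
    have "norm (real_of_int (norm1 (X i * X j * X k * walk ^ m)) / (4 * CARD('n)) ^ Suc m) =
        real_of_int (norm1 (X i * X j * X k * walk ^ m)) / (4 * CARD('n)) ^ Suc m"
      by (simp add: norm1_nonneg)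
    also have "\<dots> \<le> (2 * sqrt CARD('n)) ^ 3 * 3 powr (3 / 2) * (4 * CARD('n)) ^ m * real (Suc m) powr (- 3 / 2) / (4 * CARD('n)) ^ Suc m"
      by (intro divide_right_mono norm1_XXX_walk_power) simp
    also have "\<dots> = K * real (Suc m) powr (- 3 / 2)"
      by (simp add: K_def field_simps)
    finally show "norm (real_of_int (norm1 (X i * X j * X k * walk ^ m)) / (4 * CARD('n)) ^ Suc m) \<le> K * real (Suc m) powr (- 3 / 2)" .
  qed
qed

section \<open>I_d is an ideal and contains f\<close>

lemma summable_on_sum:
  fixes f :: "'a \<Rightarrow> 'b \<Rightarrow> real"
  assumes "\<And>k. k \<in> K \<Longrightarrow> f k summable_on A"
  shows "(\<lambda>n. \<Sum>k\<in>K. f k n) summable_on A"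
  using assms by (induction K rule: infinite_finite_induct) (auto intro: summable_on_add)

lemma summable_act:
  assumes "(\<lambda>n. norm (v n)) summable_on UNIV"
  shows "(\<lambda>n. norm (act q v n)) summable_on UNIV"
proof (rule summable_on_comparison_test)
  have "(\<lambda>n. norm (v (n - k))) summable_on UNIV" for k
    using assms summable_on_reindex_bij_betw[of "\<lambda>n. n - k" UNIV UNIV "\<lambda>n. norm (v n)"]
    by (simp add: bij_diff_right)
  then show "(\<lambda>n. \<Sum>k\<in>Poly_Mapping.keys q. \<bar>of_int (Poly_Mapping.lookup q k)\<bar> * norm (v (n - k))) summable_on UNIV"
    by (intro summable_on_sum summable_on_cmult_right) auto
  show "norm (act q v n) \<le> (\<Sum>k\<in>Poly_Mapping.keys q. \<bar>of_int (Poly_Mapping.lookup q k)\<bar> * norm (v (n - k)))" for n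
    unfolding act_def by (rule sum_norm_le) (simp add: norm_mult)
qed auto

lemma Id_set_mult: "h \<in> Id_set \<Longrightarrow> q * h \<in> Id_set"
  by (simp add: Id_set_def act_mult summable_act)

lemma Id_set_add: "p \<in> Id_set \<Longrightarrow> q \<in> Id_set \<Longrightarrow> p + q \<in> Id_set"
  unfolding Id_set_def mem_Collect_eq
  using summable_on_comparison_test[OF summable_on_add[of "\<lambda>n. norm (act p wd n)" UNIV "\<lambda>n. norm (act q wd n)"],
      of "\<lambda>n. norm (act (p + q) wd n)"]
  by (simp add: act_add norm_triangle_ineq)

lemma Id_set_zero: "0 \<in> Id_set"
  by (simp add: Id_set_def act_def)

lemma fd_in_Id_set:
  assumes "CARD('n::finite) \<ge> 2"
  shows "(fd :: 'n laurent) \<in> Id_set"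
proof -
  have "(\<lambda>n::'n \<Rightarrow> int. norm (act fd wd n)) summable_on UNIV \<longleftrightarrow>
      (\<lambda>n::'n \<Rightarrow> int. norm (act fd wd n)) summable_on {0}"
    by (rule summable_on_cong_neutral) (auto simp: act_fd_wd[OF assms])
  then show ?thesis by (simp add: Id_set_def)
qed

section \<open>Obstructions to summability\<close>

lemma has_sum_sum:
  fixes f :: "'a \<Rightarrow> 'b \<Rightarrow> complex"
  assumes "\<And>k. k \<in> K \<Longrightarrow> (f k has_sum S k) A"
  shows "((\<lambda>n. \<Sum>k\<in>K. f k n) has_sum (\<Sum>k\<in>K. S k)) A"
  using assms by (induction K rule: infinite_finite_induct) (auto intro: has_sum_add)

lemma fhat_has_sum: "((\<lambda>n. of_int (Poly_Mapping.lookup g n) * cis (2 * pi * lat_inner n t)) has_sum fhat g t) UNIV"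
proof -
  have "((\<lambda>n. of_int (Poly_Mapping.lookup g n) * cis (2 * pi * lat_inner n t)) has_sum fhat g t) (Poly_Mapping.keys g)"
    unfolding fhat_def pairing_def by (rule has_sum_finite) simp
  then show ?thesis
    by (rule has_sum_cong_neutral[THEN iffD1, rotated -1]) (auto simp: in_keys_iff)
qed

text \<open>\<phi> is the Fourier series of \<open>act g wd\<close>. Absolute summability gives its
  continuity by the Weierstrass M-test and allows termwise multiplication by the transform of
  \<open>fd\<close>.\<close>

lemma Id_set_fourier_quotient:
  fixes g :: "('n::finite) laurent"
  assumes card: "CARD('n) \<ge> 2" and g: "g \<in> Id_set"
  obtains \<phi> where "continuous_on UNIV \<phi>" "\<And>t. fhat g t = of_real (Fd t) * \<phi> t"
proof
  define v where "v = act g wd"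
  have v: "(\<lambda>n. norm (v n)) summable_on UNIV"
    using g by (simp add: Id_set_def v_def)
  define \<phi> where "\<phi> t = (\<Sum>\<^sub>\<infinity>n. v n * cis (2 * pi * lat_inner n t))" for t
  have has_sum: "((\<lambda>n. v n * cis (2 * pi * lat_inner n t)) has_sum \<phi> t) UNIV" for t
    unfolding \<phi>_def
    by (rule has_sum_infsum, rule abs_summable_summable) (use v in \<open>simp add: norm_mult\<close>)
  have "uniform_limit UNIV (\<lambda>N t. \<Sum>n\<in>N. v n * cis (2 * pi * lat_inner n t)) \<phi> (finite_subsets_at_top UNIV)"
    unfolding \<phi>_def by (rule Weierstrass_m_test_general[OF _ v]) (simp add: norm_mult)
  then show "continuous_on UNIV \<phi>"
    by (rule uniform_limit_theorem[rotated]) (auto intro!: always_eventually continuous_intros)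
  fix t
  have "act fd v n = of_int (Poly_Mapping.lookup g n)" for n
  proof -
    \<comment> \<open>\<open>fd\<close> and \<open>g\<close> commute, so \<open>fd\<close> can act
      on \<open>wd\<close> first and produce the unit sequence.\<close>
    have "act fd v n = act g (act fd wd) n"
      unfolding v_def act_mult[symmetric] by (simp add: mult.commute)
    also have "\<dots> = of_int (Poly_Mapping.lookup g n)"
      unfolding act_def[of g "act fd wd"]
      by (simp add: act_fd_wd[OF card] if_distrib[of "\<lambda>x. _ * x"] in_keys_iff cong: if_cong)
    finally show ?thesis .
  qed
  then have 1: "((\<lambda>n. act fd v n * cis (2 * pi * lat_inner n t)) has_sum fhat g t) UNIV"
    using fhat_has_sum by simp
  \<comment> \<open>Translating \<open>v\<close> by k multiplies its Fourier series by the character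
    of k.\<close>
  have "((\<lambda>n. of_int (Poly_Mapping.lookup fd k) * v (n - k) * cis (2 * pi * lat_inner n t)) has_sum
      of_int (Poly_Mapping.lookup fd k) * cis (2 * pi * lat_inner k t) * \<phi> t) UNIV" for k :: "'n \<Rightarrow> int"
  proof -
    have "((\<lambda>n. v (n - k) * cis (2 * pi * lat_inner (n - k) t)) has_sum \<phi> t) UNIV"
      using has_sum[of t] has_sum_reindex_bij_betw[of "\<lambda>n. n - k" UNIV UNIV
        "\<lambda>n. v n * cis (2 * pi * lat_inner n t)" "\<phi> t"]
      by (simp add: bij_diff_right)
    then have "((\<lambda>n. of_int (Poly_Mapping.lookup fd k) * cis (2 * pi * lat_inner k t) *
        (v (n - k) * cis (2 * pi * lat_inner (n - k) t))) has_sum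
        of_int (Poly_Mapping.lookup fd k) * cis (2 * pi * lat_inner k t) * \<phi> t) UNIV"
      by (rule has_sum_cmult_right)
    moreover have "of_int (Poly_Mapping.lookup fd k) * v (n - k) * cis (2 * pi * lat_inner n t) =
        of_int (Poly_Mapping.lookup fd k) * cis (2 * pi * lat_inner k t) *
        (v (n - k) * cis (2 * pi * lat_inner (n - k) t))" for n
    proof -
      have "cis (2 * pi * lat_inner n t) = cis (2 * pi * lat_inner k t) * cis (2 * pi * lat_inner (n - k) t)"
        by (simp add: cis_mult lat_inner_diff algebra_simps)
      then show ?thesis by (simp only: mult_ac)
    qed
    ultimately show ?thesis by (simp only:)
  qed
  then have "((\<lambda>n. \<Sum>k\<in>Poly_Mapping.keys fd. of_int (Poly_Mapping.lookup fd k) * v (n - k) * cis (2 * pi * lat_inner n t))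
    has_sum (\<Sum>k\<in>Poly_Mapping.keys fd. of_int (Poly_Mapping.lookup fd k) * cis (2 * pi * lat_inner k t) * \<phi> t)) UNIV"
    by (rule has_sum_sum)
  then have 2: "((\<lambda>n. act fd v n * cis (2 * pi * lat_inner n t)) has_sum fhat fd t * \<phi> t) UNIV"
    by (simp add: act_def fhat_def pairing_def sum_distrib_right)
  show "fhat g t = of_real (Fd t) * \<phi> t"
    using has_sum_unique[OF 1 2] by (simp add: fhat_fd)
qed

text \<open>Three rounds of \<open>laurent_decompose\<close>. The matrix \<open>c\<close> is not
  symmetrized: \<open>X i * X j\<close> and \<open>X j * X i\<close> are listed separately, so only
  the sums \<open>c i j + c j i\<close> carry information off the diagonal.\<close>

lemma laurent_second_order:
  fixes h :: "('n::finite) laurent"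
  obtains a b c r where "h = of_int a + (\<Sum>i\<in>UNIV. of_int (b i) * X i)
    + (\<Sum>i\<in>UNIV. \<Sum>j\<in>UNIV. of_int (c i j) * (X i * X j))
    + (\<Sum>i\<in>UNIV. \<Sum>j\<in>UNIV. \<Sum>k\<in>UNIV. X i * X j * X k * r i j k)"
proof -
  have "\<exists>q. \<forall>h :: 'n laurent. h = of_int (eval_one h) + (\<Sum>i\<in>UNIV. X i * q h i)"
    by (intro choice allI laurent_decompose)
  then obtain q where q: "\<And>h :: 'n laurent. h = of_int (eval_one h) + (\<Sum>i\<in>UNIV. X i * q h i)"
    by blast
  let ?b = "\<lambda>i. eval_one (q h i)" and ?c = "\<lambda>i j. eval_one (q (q h i) j)" and ?r = "\<lambda>i j. q (q (q h i) j)"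
  have "h = of_int (eval_one h) + (\<Sum>i\<in>UNIV. X i * q h i)"
    by (rule q)
  also have "(\<Sum>i\<in>UNIV. X i * q h i) = (\<Sum>i\<in>UNIV. X i * (of_int (?b i) + (\<Sum>j\<in>UNIV. X j * q (q h i) j)))"
    by (rule sum.cong[OF refl], subst q) (rule refl)
  also have "\<dots> = (\<Sum>i\<in>UNIV. X i * (of_int (?b i) + (\<Sum>j\<in>UNIV. X j * (of_int (?c i j) + (\<Sum>k\<in>UNIV. X k * ?r i j k)))))"
    by (intro sum.cong[OF refl] arg_cong2[of _ _ _ _ "(*)"] arg_cong2[of _ _ _ _ "(+)"] refl q)
  also have "\<dots> = (\<Sum>i\<in>UNIV. of_int (?b i) * X i)
    + (\<Sum>i\<in>UNIV. \<Sum>j\<in>UNIV. of_int (?c i j) * (X i * X j))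
    + (\<Sum>i\<in>UNIV. \<Sum>j\<in>UNIV. \<Sum>k\<in>UNIV. X i * X j * X k * ?r i j k)"
    unfolding distrib_left sum.distrib sum_distrib_left by (simp only: mult_ac add.assoc)
  finally show ?thesis
    by (intro that[of "eval_one h" ?b ?c ?r]) (simp only: add.assoc)
qed

section \<open>Comparison to second order along lines through the origin\<close>

lemma cis_difference_quotient: "((\<lambda>s. (cis (a * s) - 1) / of_real s) \<longlongrightarrow> \<i> * of_real a) (at 0)"
proof -
  have "((\<lambda>z. exp (\<i> * of_real a * z)) has_field_derivative \<i> * of_real a) (at 0)"
    by (auto intro!: derivative_eq_intros)
  then have "((\<lambda>z. (exp (\<i> * of_real a * z) - 1) / z) \<longlongrightarrow> \<i> * of_real a) (at 0)"
    by (simp add: DERIV_def)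
  moreover have "filterlim complex_of_real (at 0) (at 0)"
    by (auto simp: filterlim_at eventually_at_filter intro!: tendsto_eq_intros)
  ultimately have "((\<lambda>s. (exp (\<i> * of_real a * of_real s) - 1) / of_real s) \<longlongrightarrow> \<i> * of_real a) (at 0)"
    by (rule filterlim_compose)
  then show ?thesis
    by (simp add: cis_conv_exp mult.assoc)
qed

text \<open>On the line t = s v the transform of \<open>X i\<close> divided by s tends to 2 pi i
  v_i, and F divided by s^2 tends to 4 pi^2 |v|^2. Evaluating at 0, then dividing by s and by s^2,
  isolates the terms of degree 0, 1 and 2.\<close>

lemma quadratic_quotient:
  fixes a :: int and b :: "'n::finite \<Rightarrow> int" and c :: "'n \<Rightarrow> 'n \<Rightarrow> int" and \<phi> :: "real^'n \<Rightarrow> complex"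
  defines "p \<equiv> of_int a + (\<Sum>i\<in>UNIV. of_int (b i) * X i) + (\<Sum>i\<in>UNIV. \<Sum>j\<in>UNIV. of_int (c i j) * (X i * X j))"
  assumes \<phi>: "continuous_on UNIV \<phi>" and p: "\<And>t. fhat p t = of_real (Fd t) * \<phi> t"
  shows "a = 0" and "b i = 0"
    and "(\<Sum>i\<in>UNIV. \<Sum>j\<in>UNIV. of_int (c i j) * of_real (v $ i) * of_real (v $ j)) =
      - \<phi> 0 * (\<Sum>i\<in>UNIV. (of_real (v $ i))\<^sup>2)"
proof -
  have fhat_p: "fhat p t = of_int a + (\<Sum>i\<in>UNIV. of_int (b i) * fhat (X i) t)
      + (\<Sum>i\<in>UNIV. \<Sum>j\<in>UNIV. of_int (c i j) * (fhat (X i) t * fhat (X j) t))" for t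
    unfolding p_def by (simp only: fhat_add fhat_sum fhat_mult fhat_of_int)
  show a: "a = 0"
    using p[of 0] by (simp add: fhat_p fhat_X Fd_zero)
  define x where "x v i s = fhat (X i) (s *\<^sub>R v) / of_real s" for v :: "real^'n" and i s
  have x: "(x v i \<longlongrightarrow> 2 * pi * \<i> * of_real (v $ i)) (at 0)" for v :: "real^'n" and i
  proof -
    have "x v i = (\<lambda>s. (cis (2 * pi * v $ i * s) - 1) / of_real s)"
      by (simp add: x_def fhat_X fun_eq_iff mult_ac)
    then show ?thesis
      using cis_difference_quotient[of "2 * pi * v $ i"] by (simp add: mult_ac)
  qed
  have F: "((\<lambda>s. of_real (Fd (s *\<^sub>R v)) / (of_real s)\<^sup>2) \<longlongrightarrow>
      (\<Sum>i\<in>UNIV. of_real ((norm (2 * pi * \<i> * complex_of_real (v $ i)))\<^sup>2) :: complex)) (at 0)" for v :: "real^'n"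
  proof -
    have "of_real (Fd (s *\<^sub>R v)) / (of_real s)\<^sup>2 = (\<Sum>i\<in>UNIV. of_real ((norm (x v i s))\<^sup>2) :: complex)" for s
    proof -
      have "Fd (s *\<^sub>R v) / s\<^sup>2 = (\<Sum>i\<in>UNIV. (norm (x v i s))\<^sup>2)"
        unfolding Fd_eq_sum norm_fhat_X[symmetric] x_def sum_divide_distrib
        by (simp add: norm_divide power_divide)
      then show ?thesis
        by (simp only: of_real_sum flip: of_real_divide of_real_power)
    qed
    moreover have "((\<lambda>s. \<Sum>i\<in>UNIV. of_real ((norm (x v i s))\<^sup>2) :: complex) \<longlongrightarrow>
        (\<Sum>i\<in>UNIV. of_real ((norm (2 * pi * \<i> * complex_of_real (v $ i)))\<^sup>2))) (at 0)"
      by (intro tendsto_intros x)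
    ultimately show ?thesis by simp
  qed
  have phi: "((\<lambda>s. \<phi> (s *\<^sub>R v)) \<longlongrightarrow> \<phi> 0) (at 0)" for v :: "real^'n"
  proof -
    have "continuous_on UNIV (\<lambda>s. \<phi> (s *\<^sub>R v))"
      by (rule continuous_on_compose2[OF \<phi>]) (auto intro!: continuous_intros)
    then have "isCont (\<lambda>s. \<phi> (s *\<^sub>R v)) 0"
      by (simp add: continuous_on_eq_continuous_at)
    then show ?thesis by (simp add: isCont_def)
  qed
  \<comment> \<open>After division by s the right side is (F/s^2) \<phi> s. It tends to 0, since F
    has no linear term.\<close>
  have linear: "(\<Sum>i\<in>UNIV. of_int (b i) * of_real (v $ i)) = (0 :: complex)" for v :: "real^'n"
  proof -
    have eq: "(\<Sum>i\<in>UNIV. of_int (b i) * x v i s) + (\<Sum>i\<in>UNIV. \<Sum>j\<in>UNIV. of_int (c i j) * (x v i s * x v j s)) * of_real s =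
        of_real (Fd (s *\<^sub>R v)) / (of_real s)\<^sup>2 * \<phi> (s *\<^sub>R v) * of_real s" if "s \<noteq> 0" for s
    proof -
      have "fhat p (s *\<^sub>R v) / of_real s = of_real (Fd (s *\<^sub>R v)) * \<phi> (s *\<^sub>R v) / of_real s"
        by (simp add: p)
      then show ?thesis
        using that unfolding fhat_p a x_def
        by (simp add: add_divide_distrib sum_divide_distrib sum_distrib_right power2_eq_square)
    qed
    have "((\<lambda>s. (\<Sum>i\<in>UNIV. of_int (b i) * x v i s) + (\<Sum>i\<in>UNIV. \<Sum>j\<in>UNIV. of_int (c i j) * (x v i s * x v j s)) * of_real s)
      \<longlongrightarrow> (\<Sum>i\<in>UNIV. of_int (b i) * (2 * pi * \<i> * of_real (v $ i))) +
        (\<Sum>i\<in>UNIV. \<Sum>j\<in>UNIV. of_int (c i j) * ((2 * pi * \<i> * of_real (v $ i)) * (2 * pi * \<i> * of_real (v $ j)))) * of_real 0) (at 0)"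
      by (intro tendsto_intros x)
    moreover have "((\<lambda>s. of_real (Fd (s *\<^sub>R v)) / (of_real s)\<^sup>2 * \<phi> (s *\<^sub>R v) * of_real s) \<longlongrightarrow>
        (\<Sum>i\<in>UNIV. of_real ((norm (2 * pi * \<i> * complex_of_real (v $ i)))\<^sup>2)) * \<phi> 0 * of_real 0) (at 0)"
      by (intro tendsto_intros F phi)
    then have "((\<lambda>s. (\<Sum>i\<in>UNIV. of_int (b i) * x v i s) + (\<Sum>i\<in>UNIV. \<Sum>j\<in>UNIV. of_int (c i j) * (x v i s * x v j s)) * of_real s)
        \<longlongrightarrow> (\<Sum>i\<in>UNIV. of_real ((norm (2 * pi * \<i> * complex_of_real (v $ i)))\<^sup>2)) * \<phi> 0 * of_real 0) (at 0)"
      by (rule Lim_transform_within[where d = 1]) (auto simp: eq)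
    ultimately have "(\<Sum>i\<in>UNIV. of_int (b i) * (2 * pi * \<i> * of_real (v $ i))) +
        (\<Sum>i\<in>UNIV. \<Sum>j\<in>UNIV. of_int (c i j) * ((2 * pi * \<i> * of_real (v $ i)) * (2 * pi * \<i> * of_real (v $ j)))) * of_real 0
        = (\<Sum>i\<in>UNIV. of_real ((norm (2 * pi * \<i> * complex_of_real (v $ i)))\<^sup>2)) * \<phi> 0 * of_real 0"
      by (rule tendsto_unique[OF trivial_limit_at])
    then have "(2 * pi * \<i>) * (\<Sum>i\<in>UNIV. of_int (b i) * of_real (v $ i)) = 0"
      by (simp add: sum_distrib_left mult_ac)
    then show ?thesis by simp
  qed
  have b: "b i = 0" for i
    using linear[of "axis i 1"] by (simp add: axis_def if_distrib[of "\<lambda>x. _ * complex_of_real x"] cong: if_cong)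
  then show "b i = 0" .
  \<comment> \<open>At s = 0 both sides are 0, by the convention for division by 0, so the identity
    holds for every s.\<close>
  have eq: "(\<Sum>i\<in>UNIV. \<Sum>j\<in>UNIV. of_int (c i j) * (x v i s * x v j s)) =
      of_real (Fd (s *\<^sub>R v)) / (of_real s)\<^sup>2 * \<phi> (s *\<^sub>R v)" for s
  proof -
    have "fhat p (s *\<^sub>R v) / (of_real s)\<^sup>2 = of_real (Fd (s *\<^sub>R v)) * \<phi> (s *\<^sub>R v) / (of_real s)\<^sup>2"
      by (simp add: p)
    then show ?thesis
      unfolding fhat_p a b x_def by (simp add: sum_divide_distrib power2_eq_square)
  qed
  have "((\<lambda>s. \<Sum>i\<in>UNIV. \<Sum>j\<in>UNIV. of_int (c i j) * (x v i s * x v j s))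
      \<longlongrightarrow> (\<Sum>i\<in>UNIV. \<Sum>j\<in>UNIV. of_int (c i j) * ((2 * pi * \<i> * of_real (v $ i)) * (2 * pi * \<i> * of_real (v $ j))))) (at 0)"
    by (intro tendsto_intros x)
  moreover have "((\<lambda>s. \<Sum>i\<in>UNIV. \<Sum>j\<in>UNIV. of_int (c i j) * (x v i s * x v j s)) \<longlongrightarrow>
      (\<Sum>i\<in>UNIV. of_real ((norm (2 * pi * \<i> * complex_of_real (v $ i)))\<^sup>2)) * \<phi> 0) (at 0)"
    unfolding eq by (intro tendsto_intros F phi)
  ultimately have "(\<Sum>i\<in>UNIV. \<Sum>j\<in>UNIV. of_int (c i j) * ((2 * pi * \<i> * of_real (v $ i)) * (2 * pi * \<i> * of_real (v $ j))))
      = (\<Sum>i\<in>UNIV. of_real ((norm (2 * pi * \<i> * complex_of_real (v $ i)))\<^sup>2)) * \<phi> 0"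
    by (rule tendsto_unique[OF trivial_limit_at])
  \<comment> \<open>The square of 2 pi i is negative, whereas F involves its squared modulus: hence
    the sign in front of \<open>\<phi> 0\<close>.\<close>
  also have "(\<Sum>i\<in>UNIV. \<Sum>j\<in>UNIV. of_int (c i j) * ((2 * pi * \<i> * of_real (v $ i)) * (2 * pi * \<i> * of_real (v $ j))))
      = - ((of_real (2 * pi))\<^sup>2 * (\<Sum>i\<in>UNIV. \<Sum>j\<in>UNIV. of_int (c i j) * complex_of_real (v $ i) * of_real (v $ j)))"
    unfolding sum_distrib_left sum_negf[symmetric]
    by (intro sum.cong refl) (simp add: power2_eq_square)
  also have "(\<Sum>i\<in>UNIV. complex_of_real ((norm (2 * pi * \<i> * complex_of_real (v $ i)))\<^sup>2)) = (of_real (2 * pi))\<^sup>2 * (\<Sum>i\<in>UNIV. (of_real (v $ i))\<^sup>2)"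
    unfolding sum_distrib_left
    by (intro sum.cong refl) (simp add: norm_mult power_mult_distrib flip: of_real_power)
  finally have "(complex_of_real (2 * pi))\<^sup>2 * (\<Sum>i\<in>UNIV. \<Sum>j\<in>UNIV. of_int (c i j) * of_real (v $ i) * of_real (v $ j)) =
      (complex_of_real (2 * pi))\<^sup>2 * (- \<phi> 0 * (\<Sum>i\<in>UNIV. (of_real (v $ i))\<^sup>2))"
    by (simp add: minus_equation_iff mult_ac)
  moreover have "(complex_of_real (2 * pi))\<^sup>2 \<noteq> 0"
    by simp
  ultimately show "(\<Sum>i\<in>UNIV. \<Sum>j\<in>UNIV. of_int (c i j) * of_real (v $ i) * of_real (v $ j)) =
      - \<phi> 0 * (\<Sum>i\<in>UNIV. (of_real (v $ i))\<^sup>2)"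
    by (rule mult_left_cancel[THEN iffD1, rotated])
qed

text \<open>Polarization: the vectors e_i give the diagonal, the vectors e_i + e_j the symmetrized
  off-diagonal entries.\<close>

lemma quadratic_form_scalar:
  fixes c :: "'n::finite \<Rightarrow> 'n \<Rightarrow> int" and z :: complex
  assumes "\<And>v :: real^'n. (\<Sum>i\<in>UNIV. \<Sum>j\<in>UNIV. of_int (c i j) * of_real (v $ i) * of_real (v $ j)) =
      z * (\<Sum>i\<in>UNIV. (of_real (v $ i))\<^sup>2)"
  shows "of_int (c i i) = z" and "i \<noteq> j \<Longrightarrow> c i j + c j i = 0"
proof -
  have sum: "(\<Sum>k\<in>UNIV. f k * complex_of_real (axis i 1 $ k)) = f i" for f :: "'n \<Rightarrow> complex" and i
    by (simp add: axis_def if_distrib[of "\<lambda>x. _ * complex_of_real x"] cong: if_cong)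
  have bilinear: "(\<Sum>k\<in>UNIV. \<Sum>l\<in>UNIV. of_int (c k l) * of_real (axis i 1 $ k) * of_real (axis j 1 $ l)) = (of_int (c i j) :: complex)" for i j
    unfolding sum sum[of "\<lambda>k. of_int (c k j)"] ..
  have square: "(\<Sum>k\<in>UNIV. of_real (axis i 1 $ k) * of_real (axis j 1 $ k)) = (if i = j then 1 else 0 :: complex)" for i j :: 'n
    unfolding sum by (simp add: axis_def)
  show diag: "of_int (c i i) = z" for i
    using assms[of "axis i 1"] unfolding bilinear power2_eq_square square by simp
  assume "i \<noteq> j"
  have "of_int (c i i) + of_int (c i j) + of_int (c j i) + of_int (c j j) = z * 2"
    using assms[of "axis i 1 + axis j 1"] \<open>i \<noteq> j\<close>
    unfolding vector_add_component of_real_add power2_eq_square distrib_left distrib_right sum.distrib bilinear square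
    by (simp add: add_ac mult.commute)
  then have "of_int (c i j + c j i) = (0 :: complex)"
    unfolding diag by simp
  then show "c i j + c j i = 0"
    by (simp only: of_int_eq_0_iff)
qed

text \<open>Adding the sum to its transpose cancels the off-diagonal part and doubles the diagonal.
  The factor 2 is then removed coefficientwise, the coefficients being integers.\<close>

lemma sum_antisymmetric_plus_scalar:
  fixes c :: "'n::finite \<Rightarrow> 'n \<Rightarrow> int" and x :: "'n \<Rightarrow> 'm laurent"
  assumes "\<And>i. c i i = d" and "\<And>i j. i \<noteq> j \<Longrightarrow> c i j + c j i = 0"
  shows "(\<Sum>i\<in>UNIV. \<Sum>j\<in>UNIV. of_int (c i j) * (x i * x j)) = of_int d * (\<Sum>i\<in>UNIV. x i * x i)"
    (is "?L = ?R")
proof -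
  have "?L = (\<Sum>i\<in>UNIV. \<Sum>j\<in>UNIV. of_int (c j i) * (x i * x j))"
    by (subst sum.swap) (simp add: mult.commute)
  then have "?L + ?L = (\<Sum>i\<in>UNIV. \<Sum>j\<in>UNIV. of_int (c i j + c j i) * (x i * x j))"
    by (simp add: distrib_right sum.distrib)
  also have "\<dots> = (\<Sum>i\<in>UNIV. \<Sum>j\<in>UNIV. if j = i then of_int (d + d) * (x i * x i) else 0)"
  proof (intro sum.cong refl)
    fix i j
    show "of_int (c i j + c j i) * (x i * x j) = (if j = i then of_int (d + d) * (x i * x i) else 0)"
    proof (cases "j = i")
      case True
      then show ?thesis using assms(1)[of i] by (simp del: of_int_add)
    next
      case False
      then have "c i j + c j i = 0" using assms(2)[of i j] by blast
      then show ?thesis using False by (simp only: of_int_0 mult_zero_left if_False)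
    qed
  qed
  also have "\<dots> = ?R + ?R"
    by (simp add: sum_distrib_left distrib_right sum.distrib mult.assoc)
  finally have double: "?L + ?L = ?R + ?R" .
  show ?thesis
  proof (rule poly_mapping_eqI)
    fix k
    have "Poly_Mapping.lookup (?L + ?L) k = Poly_Mapping.lookup (?R + ?R) k"
      unfolding double ..
    then have "Poly_Mapping.lookup ?L k + Poly_Mapping.lookup ?L k = Poly_Mapping.lookup ?R k + Poly_Mapping.lookup ?R k"
      by (simp only: lookup_add)
    then show "Poly_Mapping.lookup ?L k = Poly_Mapping.lookup ?R k"
      by linarith
  qed
qed

text \<open>Writing u_i = 1 + x_i gives x_i^2 = x_i^2 u_i^(-1) + x_i^3 u_i^(-1), and x_i^2 u_i^(-1)
  = u_i - 2 + u_i^(-1) is the i-th part of -f. The cubic error is thus explicit.\<close>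

lemma sum_X_squared:
  "(\<Sum>i\<in>UNIV. X i * X i) = - fd + (\<Sum>i\<in>UNIV. X i * X i * X i * mono (- unitvec i) :: ('n::finite) laurent)"
proof -
  have "X i * X i = - (2 - (mono (unitvec i) + mono (- unitvec i))) + X i * X i * X i * mono (- unitvec i)" for i :: 'n
  proof -
    have inv: "mono (unitvec i) * mono (- unitvec i) = 1"
      by (metis mono_add mono_zero add.right_inverse)
    have "X i * X i * X i * mono (- unitvec i) =
        X i * X i * (mono (unitvec i) * mono (- unitvec i)) - (mono (unitvec i) - 2) * (mono (unitvec i) * mono (- unitvec i)) - mono (- unitvec i)"
      by (simp add: algebra_simps)
    then show ?thesis unfolding inv by simp
  qed
  then have "(\<Sum>i\<in>UNIV. X i * X i) = (\<Sum>i\<in>(UNIV :: 'n set). - (2 - (mono (unitvec i) + mono (- unitvec i))) + X i * X i * X i * mono (- unitvec i))"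
    by (rule sum.cong[OF refl])
  also have "\<dots> = - fd + (\<Sum>i\<in>UNIV. X i * X i * X i * mono (- unitvec i))"
    unfolding sum.distrib sum_negf sum_subtractf fd_def by simp
  finally show ?thesis .
qed

section \<open>The ideal identity\<close>

abbreviation augm_cube :: "('n::finite) laurent set" where
  "augm_cube \<equiv> ideal_mult (ideal_mult augm_ideal augm_ideal) augm_ideal"

lemma ideal_mult_zero: "0 \<in> ideal_mult A B"
  unfolding ideal_mult_def by (intro CollectI exI[of _ "[]"]) simp

lemma ideal_mult_add: "x \<in> ideal_mult A B \<Longrightarrow> y \<in> ideal_mult A B \<Longrightarrow> x + y \<in> ideal_mult A B"
  unfolding ideal_mult_def
proof clarsimp
  fix xs ys
  assume "set xs \<subseteq> A \<times> B" "set ys \<subseteq> A \<times> B"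
  then show "\<exists>zs. set zs \<subseteq> A \<times> B \<and>
      (\<Sum>(a, b)\<leftarrow>xs. a * b) + (\<Sum>(a, b)\<leftarrow>ys. a * b) = (\<Sum>(a, b)\<leftarrow>zs. a * b)"
    by (intro exI[of _ "xs @ ys"]) simp
qed

lemma ideal_mult_sum: "(\<And>i. i \<in> S \<Longrightarrow> f i \<in> ideal_mult A B) \<Longrightarrow> sum f S \<in> ideal_mult A B"
  by (induction S rule: infinite_finite_induct) (auto intro: ideal_mult_zero ideal_mult_add)

lemma ideal_multI: "a \<in> A \<Longrightarrow> b \<in> B \<Longrightarrow> a * b \<in> ideal_mult A B"
  unfolding ideal_mult_def by (intro CollectI exI[of _ "[(a, b)]"]) simp

lemma ideal_mult_induct:
  assumes "x \<in> ideal_mult A B" and "P 0" and "\<And>x y. P x \<Longrightarrow> P y \<Longrightarrow> P (x + y)"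
    and "\<And>a b. a \<in> A \<Longrightarrow> b \<in> B \<Longrightarrow> P (a * b)"
  shows "P x"
proof -
  obtain xs where xs: "set xs \<subseteq> A \<times> B" "x = (\<Sum>(a, b)\<leftarrow>xs. a * b)"
    using assms(1) by (auto simp: ideal_mult_def)
  from xs(1) have "P (\<Sum>(a, b)\<leftarrow>xs. a * b)"
    by (induction xs) (auto intro: assms(2-4))
  then show ?thesis by (simp add: xs(2))
qed

lemma X_mult_in_augm_ideal: "X i * q \<in> augm_ideal"
  by (simp add: augm_ideal_def eval_one_eq_zero_iff fhat_mult fhat_X)

lemma XXX_in_augm_cube: "X i * X j * X k * q \<in> augm_cube"
proof -
  have "X i * 1 * (X j * 1) * (X k * q) \<in> augm_cube"
    by (intro ideal_multI X_mult_in_augm_ideal)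
  then show ?thesis by (simp add: mult.assoc)
qed

text \<open>Only products of three generators have been estimated. \<open>step\<close> replaces one
  generator by an arbitrary element of the augmentation ideal, using that I_d is closed under sums
  and multiples; three applications reach every product of three elements.\<close>

lemma augm_cube_subset_Id_set:
  assumes card: "CARD('n::finite) \<ge> 2"
  shows "(augm_cube :: 'n laurent set) \<subseteq> Id_set"
proof
  have Id_sum: "sum f S \<in> Id_set" if "\<And>i. i \<in> S \<Longrightarrow> f i \<in> Id_set" for f :: "'n \<Rightarrow> 'n laurent" and S
    using that by (induction S rule: infinite_finite_induct) (auto intro: Id_set_zero Id_set_add)
  have step: "a * y \<in> Id_set" if a: "a \<in> augm_ideal" and y: "\<And>i. X i * y \<in> Id_set" for a y :: "'n laurent"
  proof -
    obtain q where "a = (\<Sum>i\<in>UNIV. X i * q i)"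
      using laurent_decompose[of a] a by (auto simp: augm_ideal_def)
    then have "a * y = (\<Sum>i\<in>UNIV. q i * (X i * y))"
      by (simp only: sum_distrib_right) (simp only: mult_ac)
    then show ?thesis by (simp only: Id_sum Id_set_mult y)
  qed
  have triple: "a * b * c \<in> Id_set" if "a \<in> augm_ideal" "b \<in> augm_ideal" "c \<in> augm_ideal" for a b c :: "'n laurent"
  proof -
    have "X k * (X i * X j) \<in> Id_set" for i j k :: 'n
      using XXX_in_Id_set[OF card, of k i j] by (simp only: mult.assoc)
    then have "c * (X i * X j) \<in> Id_set" for i j
      by (rule step[OF that(3)])
    then have "X j * (X i * c) \<in> Id_set" for i j
      by (simp only: mult_ac)
    then have "b * (X i * c) \<in> Id_set" for i
      by (rule step[OF that(2)])
    then have "X i * (b * c) \<in> Id_set" for i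
      by (simp only: mult.left_commute)
    then have "a * (b * c) \<in> Id_set"
      by (rule step[OF that(1)])
    then show ?thesis by (simp only: mult.assoc)
  qed
  fix x :: "'n laurent"
  assume "x \<in> augm_cube"
  then show "x \<in> Id_set"
  proof (rule ideal_mult_induct)
    fix y c :: "'n laurent"
    assume y: "y \<in> ideal_mult augm_ideal augm_ideal" and c: "c \<in> augm_ideal"
    from y show "y * c \<in> Id_set"
      by (rule ideal_mult_induct) (auto simp: distrib_right intro: Id_set_zero Id_set_add triple c)
  qed (auto intro: Id_set_zero Id_set_add)
qed

theorem theorem2p4:
  assumes "CARD('n::finite) \<ge> 2"
  shows "(Id_set :: 'n laurent set) =
    ideal_sum (principal_ideal fd) (ideal_mult (ideal_mult augm_ideal augm_ideal) augm_ideal)"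
proof (intro equalityI subsetI)
  fix g :: "'n laurent"
  assume "g \<in> ideal_sum (principal_ideal fd) augm_cube"
  then obtain q r where "g = q * fd + r" "r \<in> augm_cube"
    by (auto simp: ideal_sum_def principal_ideal_def mult.commute)
  then show "g \<in> Id_set"
    using augm_cube_subset_Id_set[OF assms] by (auto intro!: Id_set_add Id_set_mult fd_in_Id_set[OF assms])
next
  fix g :: "'n laurent"
  assume g: "g \<in> Id_set"
  obtain a b c r where g_eq: "g = of_int a + (\<Sum>i\<in>UNIV. of_int (b i) * X i)
      + (\<Sum>i\<in>UNIV. \<Sum>j\<in>UNIV. of_int (c i j) * (X i * X j))
      + (\<Sum>i\<in>UNIV. \<Sum>j\<in>UNIV. \<Sum>k\<in>UNIV. X i * X j * X k * r i j k)"
    using laurent_second_order .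
  define R where "R = (\<Sum>i\<in>UNIV. \<Sum>j\<in>UNIV. \<Sum>k\<in>UNIV. X i * X j * X k * r i j k)"
  define p where "p = of_int a + (\<Sum>i\<in>UNIV. of_int (b i) * X i)
      + (\<Sum>i\<in>UNIV. \<Sum>j\<in>UNIV. of_int (c i j) * (X i * X j))"
  have R: "R \<in> augm_cube"
    unfolding R_def by (intro ideal_mult_sum XXX_in_augm_cube)
  \<comment> \<open>The inclusion of the cube in I_d is used here for the converse: removing the
    cubic remainder does not leave I_d.\<close>
  have "p = g + (- 1) * R"
    by (simp add: g_eq p_def R_def)
  also have "\<dots> \<in> Id_set"
    using R augm_cube_subset_Id_set[OF assms] g by (intro Id_set_add Id_set_mult) auto
  finally have "p \<in> Id_set" .
  then obtain \<phi> where \<phi>: "continuous_on UNIV \<phi>" "\<And>t. fhat p t = of_real (Fd t) * \<phi> t"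
    using Id_set_fourier_quotient[OF assms] by blast
  note quot = quadratic_quotient[OF \<phi>(1) \<phi>(2)[unfolded p_def]]
  have c: "of_int (c i i) = - \<phi> 0" "i \<noteq> j \<Longrightarrow> c i j + c j i = 0" for i j
    using quadratic_form_scalar[of c "- \<phi> 0"] quot(3) by blast+
  obtain i0 :: 'n where True by simp
  define d where "d = c i0 i0"
  \<comment> \<open>All diagonal entries equal the same complex number \<open>- \<phi> 0\<close>, so
    as integers they agree with the one at an arbitrary index \<open>i0\<close>.\<close>
  have d: "c i i = d" for i
    using c(1)[of i] c(1)[of i0] unfolding d_def by (metis of_int_eq_iff)
  have "p = (\<Sum>i\<in>UNIV. \<Sum>j\<in>UNIV. of_int (c i j) * (X i * X j))"
    unfolding p_def quot(1) quot(2) by simp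
  also have "\<dots> = of_int d * (\<Sum>i\<in>UNIV. X i * X i)"
    by (rule sum_antisymmetric_plus_scalar[OF d c(2)])
  \<comment> \<open>The quadratic part is d times the sum of the squares of the \<open>X i\<close>,
    that is -d f up to cubic terms.\<close>
  also have "\<dots> = fd * of_int (- d) + (\<Sum>i\<in>UNIV. X i * X i * X i * (mono (- unitvec i) * of_int d))"
    unfolding sum_X_squared by (simp add: right_diff_distrib sum_distrib_left mult_ac)
  finally have "g = fd * of_int (- d) + ((\<Sum>i\<in>UNIV. X i * X i * X i * (mono (- unitvec i) * of_int d)) + R)"
    by (simp add: g_eq p_def R_def)
  moreover have "(\<Sum>i\<in>UNIV. X i * X i * X i * (mono (- unitvec i) * of_int d)) + R \<in> augm_cube"
    by (intro ideal_mult_add ideal_mult_sum XXX_in_augm_cube R)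
  ultimately show "g \<in> ideal_sum (principal_ideal fd) augm_cube"
    unfolding ideal_sum_def principal_ideal_def by blast
qed

end
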